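(* Let $X$ be a compact metrizable space. The $\Gamma$ rank $A\mapsto |A|_{\Gamma}$ on $C_{\Gamma}=\{A\in K(X\times X):\Gamma^{\infty}(A)=X\times X\}$ is a coanalytic rank on $C_\Gamma$ (as a subset of the Polish space $K(X\times X)$).
   Context: $K(Y)$ is the space of compact subsets of $Y$ with the Vietoris topology (Hausdorff metric). $\Delta_X=\{(x,x):x\in X\}$. For $F\subseteq X^2$ the transitive closure is $F^+=\{(u,v)\in X^2:\exists\, u=u_1,\dots,u_n=v \text{ with }(u_i,u_{i+1})\in F \text{ for all } i<n\}$. The map $\Gamma\colon K(X\times X)\to K(X\times X)$ is $\Gamma(E)=\overline{E^+\cup\Delta_X}$. Put $\Gamma^0(E)=E$, $\Gamma^{\alpha+1}(E)=\Gamma(\Gamma^{\alpha}(E))$, and $\Gamma^{\lambda}(E)=\overline{\bigcup_{\beta<\lambda}\Gamma^{\beta}(E)}$ for limit $\lambda$. $|E|_{\Gamma}$ is the least ordinal $\alpha$ with $\Gamma^{\alpha}(E)=\Gamma^{\alpha+1}(E)$ (it is a countable ordinal), and $\Gamma^{\infty}(E)=\Gamma^{|E|_\Gamma}(E)$. Coanalytic rank: let $Y$ be a Polish space and $C\subseteq Y$ a coanalytic subset. A function $\varphi\colon C\to\omega_1$ is a coanalytic rank on $C$ if there are $P,Q\subseteq Y^2$ with $P$ and $Y^2\setminus Q$ analytic such that for all $y\in C$: $\{x\in C:\varphi(x)\le\varphi(y)\}=\{x\in Y:(x,y)\in P\}=\{x\in Y:(x,y)\in Q\}$. (In particular the claim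 includes that $C_\Gamma$ is coanalytic.) *)

theory Defs
  imports "HOL-Analysis.Analysis"
begin

section \<open>Countable ordinals\<close>

typedef omega1 = "Field (cardSuc natLeq)"
  morphisms Rep_omega1 Abs_omega1
  using Field_cardSuc_not_empty[OF natLeq_Card_order] by blast

lemma Well_order_cardSuc_natLeq: "Well_order (cardSuc natLeq)"
  by (simp add: cardSuc_Well_order natLeq_Card_order)

instantiation omega1 :: wellorder
begin

definition less_eq_omega1 :: "omega1 \<Rightarrow> omega1 \<Rightarrow> bool"
  where "\<alpha> \<le> \<beta> \<longleftrightarrow> (Rep_omega1 \<alpha>, Rep_omega1 \<beta>) \<in> cardSuc natLeq"

definition less_omega1 :: "omega1 \<Rightarrow> omega1 \<Rightarrow> bool"
  where "\<alpha> < \<beta> \<longleftrightarrow> \<alpha> \<le> \<beta> \<and> \<not> \<beta> \<le> (\<alpha> :: omega1)"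

instance
proof -
  let ?r = "cardSuc natLeq"
  have lin: "Linear_order ?r" and wf: "wf (?r - Id)"
    using Well_order_cardSuc_natLeq by (auto simp: well_order_on_def)
  have refl: "a \<in> Field ?r \<Longrightarrow> (a, a) \<in> ?r" for a
    using lin by (auto simp: order_on_defs refl_on_def)
  have trans: "(a, b) \<in> ?r \<Longrightarrow> (b, c) \<in> ?r \<Longrightarrow> (a, c) \<in> ?r" for a b c
    using lin by (auto simp: order_on_defs elim: transD)
  have anti: "(a, b) \<in> ?r \<Longrightarrow> (b, a) \<in> ?r \<Longrightarrow> a = b" for a b
    using lin by (auto simp: order_on_defs dest: antisymD)
  have total: "a \<in> Field ?r \<Longrightarrow> b \<in> Field ?r \<Longrightarrow> (a, b) \<in> ?r \<or> (b, a) \<in> ?r" for a b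
    using lin refl[of a] by (cases "a = b") (auto simp: order_on_defs total_on_def)
  have wf': "wf {(\<alpha>, \<beta>). \<alpha> < (\<beta> :: omega1)}"
  proof (rule wf_subset[OF wf_inv_image[OF wf, of Rep_omega1]])
    show "{(\<alpha>, \<beta>). \<alpha> < \<beta>} \<subseteq> inv_image (?r - Id) Rep_omega1"
      by (auto simp: inv_image_def less_omega1_def less_eq_omega1_def)
  qed
  show "OFCLASS(omega1, wellorder_class)"
  proof
    fix \<alpha> \<beta> \<gamma> :: omega1
    show "\<alpha> < \<beta> \<longleftrightarrow> \<alpha> \<le> \<beta> \<and> \<not> \<beta> \<le> \<alpha>" by (rule less_omega1_def)
    show "\<alpha> \<le> \<alpha>" by (simp add: less_eq_omega1_def refl Rep_omega1)
    show "\<alpha> \<le> \<beta> \<Longrightarrow> \<beta> \<le> \<gamma> \<Longrightarrow> \<alpha> \<le> \<gamma>"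
      unfolding less_eq_omega1_def by (rule trans)
    show "\<alpha> \<le> \<beta> \<Longrightarrow> \<beta> \<le> \<alpha> \<Longrightarrow> \<alpha> = \<beta>"
      unfolding less_eq_omega1_def by (metis anti Rep_omega1_inject)
    show "\<alpha> \<le> \<beta> \<or> \<beta> \<le> \<alpha>"
      unfolding less_eq_omega1_def by (simp add: total Rep_omega1)
  next
    fix P :: "omega1 \<Rightarrow> bool" and \<alpha>
    assume "\<And>\<alpha>. (\<And>\<beta>. \<beta> < \<alpha> \<Longrightarrow> P \<beta>) \<Longrightarrow> P \<alpha>"
    then show "P \<alpha>" using wf_induct[OF wf', of P \<alpha>] by blast
  qed
qed

end

lemma countable_lessThan_omega1: "countable {..<\<alpha> :: omega1}"
proof -
  include cardinal_syntax
  let ?r = "cardSuc natLeq"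
  have "|underS ?r (Rep_omega1 \<alpha>)| <o ?r"
    by (simp add: card_of_underS cardSuc_Card_order natLeq_Card_order Rep_omega1)
  then have "|underS ?r (Rep_omega1 \<alpha>)| \<le>o natLeq"
    using cardSuc_ordLeq_ordLess[OF natLeq_Card_order card_of_Card_order] by blast
  then have "|underS ?r (Rep_omega1 \<alpha>)| \<le>o |UNIV :: nat set|"
    using card_of_nat ordIso_symmetric ordLeq_ordIso_trans by blast
  then have "countable (underS ?r (Rep_omega1 \<alpha>))"
    by (auto simp: countable_def card_of_ordLeq[symmetric])
  moreover have "Rep_omega1 ` {..<\<alpha>} \<subseteq> underS ?r (Rep_omega1 \<alpha>)"
    by (auto simp: underS_def less_omega1_def less_eq_omega1_def)
  ultimately have "countable (Rep_omega1 ` {..<\<alpha>})"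
    by (rule countable_subset[rotated])
  then show ?thesis
    by (rule countable_image_inj_on) (auto simp: inj_on_def Rep_omega1_inject)
qed

lemma uncountable_UNIV_omega1: "uncountable (UNIV :: omega1 set)"
proof
  include cardinal_syntax
  let ?r = "cardSuc natLeq"
  assume "countable (UNIV :: omega1 set)"
  then have "countable (Rep_omega1 ` UNIV)" by (rule countable_image)
  then have "countable (Field ?r)"
    using type_definition.Rep_range[OF type_definition_omega1] by simp
  then have "|Field ?r| \<le>o |UNIV :: nat set|"
    by (auto simp: countable_def card_of_ordLeq[symmetric])
  then have "|Field ?r| \<le>o natLeq"
    using card_of_nat ordLeq_ordIso_trans by blast
  moreover have "?r =o |Field ?r|"
    using card_of_Field_ordIso[OF cardSuc_Card_order[OF natLeq_Card_order]] ordIso_symmetric by blast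
  ultimately have "?r \<le>o natLeq" using ordIso_ordLeq_trans by blast
  moreover have "natLeq <o ?r" by (rule cardSuc_greater[OF natLeq_Card_order])
  ultimately show False using not_ordLess_ordLeq by blast
qed

lemma countable_bounded_omega1:
  assumes "countable (S :: omega1 set)"
  shows "\<exists>\<sigma>. \<forall>\<alpha>\<in>S. \<alpha> < \<sigma>"
proof (rule ccontr)
  assume "\<not> ?thesis"
  then have "\<exists>\<alpha>\<in>S. \<sigma> \<le> \<alpha>" for \<sigma>
    by (meson linorder_not_less)
  then have "UNIV = (\<Union>\<alpha>\<in>S. insert \<alpha> {..<\<alpha>})"
    by (fastforce simp: order_le_less)
  moreover have "countable (\<Union>\<alpha>\<in>S. insert \<alpha> {..<\<alpha>})"
    using assms countable_lessThan_omega1 by auto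
  ultimately show False using uncountable_UNIV_omega1 by simp
qed

definition ord_zero :: omega1
  where "ord_zero = (LEAST \<alpha>. True)"

definition ord_succ :: "omega1 \<Rightarrow> omega1"
  where "ord_succ \<alpha> = (LEAST \<beta>. \<alpha> < \<beta>)"

definition ord_limit :: "omega1 \<Rightarrow> bool"
  where "ord_limit \<alpha> \<longleftrightarrow> \<alpha> \<noteq> ord_zero \<and> (\<forall>\<beta>. \<alpha> \<noteq> ord_succ \<beta>)"

lemma ord_zero_le: "ord_zero \<le> \<alpha>"
  by (simp add: ord_zero_def Least_le)

lemma less_ord_succ: "\<alpha> < ord_succ \<alpha>"
  unfolding ord_succ_def by (rule LeastI_ex) (use countable_bounded_omega1[of "{\<alpha>}"] in auto)

lemma less_ord_succ_iff: "\<beta> < ord_succ \<alpha> \<longleftrightarrow> \<beta> \<le> \<alpha>"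
  using less_ord_succ[of \<alpha>] not_less_Least[of \<beta> "\<lambda>\<beta>. \<alpha> < \<beta>"]
  by (auto simp: ord_succ_def[symmetric] not_less)

lemma ord_succ_inject [simp]: "ord_succ \<alpha> = ord_succ \<beta> \<longleftrightarrow> \<alpha> = \<beta>"
  by (metis less_ord_succ_iff order_antisym order_refl)

lemma ord_succ_neq_zero [simp]: "ord_succ \<alpha> \<noteq> ord_zero"
  using less_ord_succ[of \<alpha>] ord_zero_le[of \<alpha>] by auto


section \<open>The operator \<open>\<Gamma>\<close> and its iterates\<close>

text \<open>
  Here \<open>E\<^sup>+\<close> is \<^const>\<open>trancl\<close>, i.e. chains with at least one step. Admitting one-point
  chains would only add diagonal pairs, which \<open>\<Gamma>\<close> adds anyway.
\<close>

definition Gamma :: "'a topology \<Rightarrow> ('a \<times> 'a) set \<Rightarrow> ('a \<times> 'a) set"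
  where "Gamma X E = prod_topology X X closure_of (E\<^sup>+ \<union> Id_on (topspace X))"

function Gamma_iter :: "'a topology \<Rightarrow> omega1 \<Rightarrow> ('a \<times> 'a) set \<Rightarrow> ('a \<times> 'a) set"
  where "Gamma_iter X \<alpha> E =
    (if ord_limit \<alpha> then prod_topology X X closure_of (\<Union>\<beta>\<in>{..<\<alpha>}. Gamma_iter X \<beta> E)
     else if \<alpha> = ord_zero then E
     else Gamma X (Gamma_iter X (THE \<beta>. \<alpha> = ord_succ \<beta>) E))"
  by auto
termination
proof (relation "inv_image {(\<alpha>, \<beta>). \<alpha> < \<beta>} (\<lambda>(X, \<alpha>, E). \<alpha>)")
  show "wf (inv_image {(\<alpha>, \<beta>). \<alpha> < \<beta>} (\<lambda>(X :: 'a topology, \<alpha> :: omega1, E :: ('a \<times> 'a) set). \<alpha>))"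
    by (rule wf_inv_image[OF wf])
next
  fix X :: "'a topology" and \<alpha> \<beta> and E :: "('a \<times> 'a) set"
  assume "\<beta> \<in> {..<\<alpha>}"
  then show "((X, \<beta>, E), (X, \<alpha>, E)) \<in> inv_image {(\<alpha>, \<beta>). \<alpha> < \<beta>} (\<lambda>(X, \<alpha>, E). \<alpha>)" by simp
next
  fix X :: "'a topology" and \<alpha> and E :: "('a \<times> 'a) set"
  assume "\<not> ord_limit \<alpha>" "\<alpha> \<noteq> ord_zero"
  then obtain \<beta> where "\<alpha> = ord_succ \<beta>" by (auto simp: ord_limit_def)
  then show "((X, THE \<beta>. \<alpha> = ord_succ \<beta>, E), (X, \<alpha>, E))
      \<in> inv_image {(\<alpha>, \<beta>). \<alpha> < \<beta>} (\<lambda>(X, \<alpha>, E). \<alpha>)"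
    by (simp add: less_ord_succ)
qed

declare Gamma_iter.simps [simp del]

lemma Gamma_iter_zero: "Gamma_iter X ord_zero E = E"
  by (simp add: Gamma_iter.simps ord_limit_def)

lemma Gamma_iter_succ: "Gamma_iter X (ord_succ \<alpha>) E = Gamma X (Gamma_iter X \<alpha> E)"
  by (subst Gamma_iter.simps) (simp add: ord_limit_def)

lemma Gamma_iter_limit:
  "ord_limit \<alpha> \<Longrightarrow>
    Gamma_iter X \<alpha> E = prod_topology X X closure_of (\<Union>\<beta>\<in>{..<\<alpha>}. Gamma_iter X \<beta> E)"
  by (subst Gamma_iter.simps) simp

definition Gamma_rank :: "'a topology \<Rightarrow> ('a \<times> 'a) set \<Rightarrow> omega1"
  where "Gamma_rank X E = (LEAST \<alpha>. Gamma_iter X \<alpha> E = Gamma_iter X (ord_succ \<alpha>) E)"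

definition Gamma_infinity :: "'a topology \<Rightarrow> ('a \<times> 'a) set \<Rightarrow> ('a \<times> 'a) set"
  where "Gamma_infinity X E = Gamma_iter X (Gamma_rank X E) E"

definition C_Gamma :: "'a topology \<Rightarrow> ('a \<times> 'a) set set"
  where "C_Gamma X =
    {A. compactin (prod_topology X X) A \<and> Gamma_infinity X A = topspace X \<times> topspace X}"

lemma Gamma_iter_closedin:
  assumes "closedin (prod_topology X X) E"
  shows "closedin (prod_topology X X) (Gamma_iter X \<alpha> E)"
  using assms by (subst Gamma_iter.simps) (simp add: Gamma_def del: closure_of_Un)

lemma Gamma_extensive:
  assumes "E \<subseteq> topspace X \<times> topspace X"
  shows "E \<subseteq> Gamma X E"
proof -
  have "E\<^sup>+ \<subseteq> topspace X \<times> topspace X"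
    using assms by (rule trancl_subset_Sigma)
  then have "E\<^sup>+ \<union> Id_on (topspace X) \<subseteq> Gamma X E"
    unfolding Gamma_def by (intro closure_of_subset) auto
  then show ?thesis by auto
qed

lemma Gamma_iter_mono:
  assumes E: "closedin (prod_topology X X) E" and "\<beta> \<le> \<alpha>"
  shows "Gamma_iter X \<beta> E \<subseteq> Gamma_iter X \<alpha> E"
  using \<open>\<beta> \<le> \<alpha>\<close>
proof (induction \<alpha> arbitrary: \<beta> rule: less_induct)
  case (less \<alpha>)
  have sub: "Gamma_iter X \<gamma> E \<subseteq> topspace X \<times> topspace X" for \<gamma>
    using closedin_subset[OF Gamma_iter_closedin[OF E]] by simp
  consider "\<beta> = \<alpha>" | "\<beta> < \<alpha>" "ord_limit \<alpha>" | \<gamma> where "\<beta> < \<alpha>" "\<alpha> = ord_succ \<gamma>"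
    using less.prems ord_zero_le[of \<beta>] unfolding ord_limit_def
    by (metis order_le_less order_le_less_trans order_less_irrefl)
  then show ?case
  proof cases
    case 2
    have "(\<Union>\<beta>\<in>{..<\<alpha>}. Gamma_iter X \<beta> E) \<subseteq> Gamma_iter X \<alpha> E"
      unfolding Gamma_iter_limit[OF 2(2)] by (rule closure_of_subset) (use sub in auto)
    then show ?thesis using 2 by auto
  next
    case 3
    then have "Gamma_iter X \<beta> E \<subseteq> Gamma_iter X \<gamma> E"
      using less.IH[of \<gamma> \<beta>] by (simp add: less_ord_succ less_ord_succ_iff)
    also have "\<dots> \<subseteq> Gamma_iter X \<alpha> E"
      unfolding 3 Gamma_iter_succ by (rule Gamma_extensive[OF sub])
    finally show ?thesis .
  qed simp
qed

lemma compact_metrizable_imp_second_countable: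
  assumes "compact_space Y" "metrizable_space Y"
  shows "second_countable Y"
proof -
  obtain M d where "Metric_space M d" and Y: "Y = Metric_space.mtopology M d"
    using assms(2) by (auto simp: metrizable_space_def)
  then interpret Metric_space M d by simp
  have "mtotally_bounded M"
    using assms(1) compactin_imp_mtotally_bounded[of M] by (simp add: Y compact_space_def)
  then have "\<exists>K. finite K \<and> K \<subseteq> M \<and> M \<subseteq> (\<Union>x\<in>K. mball x (1 / Suc n))" for n
    by (simp add: mtotally_bounded_def)
  then obtain K where K: "\<And>n. finite (K n)" "\<And>n. K n \<subseteq> M"
      "\<And>n. M \<subseteq> (\<Union>x\<in>K n. mball x (1 / Suc n))"
    by metis
  define \<B> where "\<B> = (\<Union>n. (\<lambda>x. mball x (1 / Suc n)) ` K n)"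
  show ?thesis
    unfolding second_countable_def
  proof (intro exI[of _ \<B>] conjI allI impI ballI)
    show "countable \<B>"
      unfolding \<B>_def by (simp add: countable_finite K(1))
    show "openin Y V" if "V \<in> \<B>" for V
      using that by (auto simp: \<B>_def Y)
    fix U x assume U: "openin Y U \<and> x \<in> U"
    then obtain r where r: "r > 0" "mball x r \<subseteq> U" and x: "x \<in> M"
      unfolding Y openin_mtopology by blast
    obtain n where n: "1 / Suc n < r / 2"
      using nat_approx_posE[of "r / 2"] r(1) by auto
    obtain z where z: "z \<in> K n" "x \<in> mball z (1 / Suc n)"
      using K(3)[of n] x by blast
    have "mball z (1 / Suc n) \<subseteq> mball x r"
    proof
      fix y assume "y \<in> mball z (1 / Suc n)"
      moreover from this have "d x y \<le> d x z + d z y"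
        using z x triangle by auto
      ultimately show "y \<in> mball x r"
        using z n commute[of x z] by auto
    qed
    then show "\<exists>V\<in>\<B>. x \<in> V \<and> V \<subseteq> U"
      using z r by (intro bexI[of _ "mball z (1 / Suc n)"]) (auto simp: \<B>_def)
  qed
qed

text \<open>The rank is well defined: the iteration stabilises at a countable stage.\<close>

lemma Gamma_iter_stabilises:
  assumes X: "compact_space X" "metrizable_space X" and E: "compactin (prod_topology X X) E"
  shows "\<exists>\<alpha>. Gamma_iter X \<alpha> E = Gamma_iter X (ord_succ \<alpha>) E"
proof -
  let ?Y = "prod_topology X X"
  have met: "metrizable_space ?Y"
    by (rule iffD2[OF metrizable_space_prod_topology disjI2[OF conjI[OF X(2) X(2)]]])
  have "compact_space ?Y" using X(1) compact_space_prod_topology[of X X] by blast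
  then have "second_countable ?Y"
    using met by (rule compact_metrizable_imp_second_countable)
  then obtain \<B> where \<B>: "countable \<B>"
      "\<forall>U x. openin ?Y U \<and> x \<in> U \<longrightarrow> (\<exists>V\<in>\<B>. x \<in> V \<and> V \<subseteq> U)"
    unfolding second_countable_def by (elim exE conjE)
  have clE: "closedin ?Y E"
    by (rule compactin_imp_closedin[OF metrizable_imp_Hausdorff_space[OF met] E])
  define a where "a V = (LEAST \<alpha>. Gamma_iter X \<alpha> E \<inter> V \<noteq> {})" for V
  obtain \<sigma> where \<sigma>: "\<And>V. V \<in> \<B> \<Longrightarrow> a V < \<sigma>"
    using countable_bounded_omega1[of "a ` \<B>"] \<B>(1) by auto
  have "Gamma_iter X \<alpha> E \<subseteq> Gamma_iter X \<sigma> E" for \<alpha>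
  proof
    fix x assume x: "x \<in> Gamma_iter X \<alpha> E"
    show "x \<in> Gamma_iter X \<sigma> E"
    proof (rule ccontr)
      assume n: "x \<notin> Gamma_iter X \<sigma> E"
      have cl: "closedin ?Y (Gamma_iter X \<gamma> E)" for \<gamma> by (rule Gamma_iter_closedin[OF clE])
      have "x \<in> topspace ?Y - Gamma_iter X \<sigma> E"
        using x n closedin_subset[OF cl[of \<alpha>]] by blast
      then obtain V where V: "V \<in> \<B>" "x \<in> V" "V \<subseteq> topspace ?Y - Gamma_iter X \<sigma> E"
        using \<B>(2) openin_diff[OF openin_topspace cl[of \<sigma>]] by meson
      have "Gamma_iter X (a V) E \<inter> V \<noteq> {}"
        unfolding a_def by (rule LeastI[of _ \<alpha>]) (use x V(2) in blast)
      moreover have "Gamma_iter X (a V) E \<subseteq> Gamma_iter X \<sigma> E"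
        using \<sigma>[OF V(1)] by (intro Gamma_iter_mono[OF clE]) simp
      ultimately show False using V(3) by blast
    qed
  qed
  moreover have "Gamma_iter X \<sigma> E \<subseteq> Gamma_iter X (ord_succ \<sigma>) E"
    using less_ord_succ by (intro Gamma_iter_mono[OF clE]) (simp add: less_imp_le)
  ultimately have "Gamma_iter X \<sigma> E = Gamma_iter X (ord_succ \<sigma>) E"
    by (intro subset_antisym)
  then show ?thesis ..
qed


section \<open>Hyperspaces, analytic sets and coanalytic ranks\<close>

text \<open>The underlying set consists of all compact subsets of \<open>Y\<close>, including the empty set.\<close>

definition Vietoris :: "'a topology \<Rightarrow> 'a set topology"
  where "Vietoris Y = topology_generated_by
    ({{K. compactin Y K \<and> K \<subseteq> U} | U. openin Y U} \<union>
     {{K. compactin Y K \<and> K \<inter> U \<noteq> {}} | U. openin Y U})"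

lemma topspace_Vietoris: "topspace (Vietoris Y) = {K. compactin Y K}"
proof (rule set_eqI)
  fix K
  have "K \<in> topspace (Vietoris Y)" if "compactin Y K"
    unfolding Vietoris_def topology_generated_by_topspace
  proof (rule UnionI[OF UnI1])
    show "{K. compactin Y K \<and> K \<subseteq> topspace Y} \<in> {{K. compactin Y K \<and> K \<subseteq> U} | U. openin Y U}"
      by (intro CollectI exI[of _ "topspace Y"] conjI refl openin_topspace)
    show "K \<in> {K. compactin Y K \<and> K \<subseteq> topspace Y}"
      using that by (simp add: compactin_subset_topspace)
  qed
  moreover have "compactin Y K" if "K \<in> topspace (Vietoris Y)"
    using that unfolding Vietoris_def topology_generated_by_topspace
    by (elim UnionE UnE CollectE exE conjE) simp_all
  ultimately show "K \<in> topspace (Vietoris Y) \<longleftrightarrow> K \<in> {K. compactin Y K}"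
    by (simp only: mem_Collect_eq) (rule iffI)
qed

definition Polish_space :: "'a topology \<Rightarrow> bool"
  where "Polish_space Y \<longleftrightarrow> completely_metrizable_space Y \<and> second_countable Y"

text \<open>
  On the function type the Euclidean topology is the product topology, so
  \<open>nat \<Rightarrow> nat\<close> is the Baire space.
\<close>

definition analytic_in :: "'a topology \<Rightarrow> 'a set \<Rightarrow> bool"
  where "analytic_in Y A \<longleftrightarrow> A \<subseteq> topspace Y \<and>
    (A = {} \<or> (\<exists>f. continuous_map (euclidean :: (nat \<Rightarrow> nat) topology) Y f \<and> range f = A))"

definition coanalytic_in :: "'a topology \<Rightarrow> 'a set \<Rightarrow> bool"
  where "coanalytic_in Y C \<longleftrightarrow> C \<subseteq> topspace Y \<and> analytic_in Y (topspace Y - C)"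

definition coanalytic_rank :: "'a topology \<Rightarrow> 'a set \<Rightarrow> ('a \<Rightarrow> omega1) \<Rightarrow> bool"
  where "coanalytic_rank Y C \<phi> \<longleftrightarrow>
    Polish_space Y \<and> coanalytic_in Y C \<and>
    (\<exists>P Q. P \<subseteq> topspace Y \<times> topspace Y \<and> Q \<subseteq> topspace Y \<times> topspace Y \<and>
      analytic_in (prod_topology Y Y) P \<and>
      analytic_in (prod_topology Y Y) (topspace Y \<times> topspace Y - Q) \<and>
      (\<forall>y\<in>C. {x \<in> C. \<phi> x \<le> \<phi> y} = {x \<in> topspace Y. (x, y) \<in> P} \<and>
             {x \<in> C. \<phi> x \<le> \<phi> y} = {x \<in> topspace Y. (x, y) \<in> Q}))"

end

(*
  Compact subsets of X x X are coded by points of the Baire space listing the basic open sets that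
  the complement contains. On codes, "Gamma(E) meets U" is a Borel condition: the relational powers
  E^k have a closed graph because X is compact, and Gamma(E) meets the open set U as soon as the
  diagonal or some E^k does.

  To compare the ranks of D and E in C_Gamma, guess a relation r on the natural numbers together
  with sets A(n), B(n) such that A(n) is the closure of D and all Gamma(A(m)) with m r n, likewise
  B(n) from E, and B(m) is proper whenever m r n. Properness makes r well-founded, without any
  quantifier over well-orders: along an infinite descending chain the sets B would contain all
  iterates of E, hence be X x X. Consequently A(n) and B(n) are the iterates of D and E at the same
  ordinal, at most the rank of E. Thus rank D <= rank E iff some guess has A(n) = X x X for some n,
  and the negation holds iff some guess has B(n) = X x X but A(n) proper. Both are continuous images
  of Borel sets of codes. A set E lies outside C_Gamma iff it is contained in a proper closed set F
  with Gamma(F) contained in F.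
*)

theory Submission
  imports Defs
begin

section \<open>Analytic subsets of the Baire space\<close>

lemma open_coordinate_vimage: "open ((\<lambda>w :: nat \<Rightarrow> nat. w i) -` A)"
  by (intro open_vimage open_discrete continuous_on_product_coordinates)

lemma open_cylinder: "open {w :: nat \<Rightarrow> nat. \<forall>k<N. w k = z k}"
proof -
  have "open (\<Inter>k\<in>{..<N}. (\<lambda>w :: nat \<Rightarrow> nat. w k) -` {z k})"
    by (intro open_INT ballI open_coordinate_vimage) simp
  also have "(\<Inter>k\<in>{..<N}. (\<lambda>w :: nat \<Rightarrow> nat. w k) -` {z k}) = {w. \<forall>k<N. w k = z k}"
    by auto
  finally show ?thesis .
qed

text \<open>A basic open set of the product restricts only finitely many coordinates, so any bound
  on their indices serves as \<open>N\<close>.\<close>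

lemma open_contains_cylinder:
  assumes "open U" "(z :: nat \<Rightarrow> nat) \<in> U"
  obtains N where "\<forall>w. (\<forall>k<N. w k = z k) \<longrightarrow> w \<in> U"
proof -
  obtain V where V: "z \<in> Pi\<^sub>E UNIV V" "finite {i. V i \<noteq> UNIV}" "Pi\<^sub>E UNIV V \<subseteq> U"
    using product_topology_open_contains_basis[of "\<lambda>_. euclidean" UNIV U z] assms
    by (auto simp: euclidean_product_topology)
  obtain N where N: "\<And>i. V i \<noteq> UNIV \<Longrightarrow> i < N"
    using V(2) by (auto simp: finite_nat_set_iff_bounded)
  have "w \<in> U" if "\<forall>k<N. w k = z k" for w
  proof -
    have "w i \<in> V i" for i
      using that N[of i] V(1) by (cases "V i = UNIV") (auto simp: PiE_iff)
    then show ?thesis using V(3) by (auto simp: PiE_iff)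
  qed
  then show thesis using that by blast
qed

text \<open>Since \<open>nat\<close> is discrete, it suffices that every output coordinate is
  locally constant, and cylinders are open neighbourhoods.\<close>

lemma continuous_on_Baire_I:
  fixes f :: "(nat \<Rightarrow> nat) \<Rightarrow> nat \<Rightarrow> nat"
  assumes "\<And>z i. \<exists>N. \<forall>w. (\<forall>k<N. w k = z k) \<longrightarrow> f w i = f z i"
  shows "continuous_on UNIV f"
proof (rule continuous_on_coordinatewise_then_product)
  fix i
  have "open ((\<lambda>w. f w i) -` B)" for B
  proof (rule topological_space_class.openI)
    fix z assume z: "z \<in> (\<lambda>w. f w i) -` B"
    obtain N where N: "\<forall>w. (\<forall>k<N. w k = z k) \<longrightarrow> f w i = f z i"
      using assms[of z i] by blast
    have "{w. \<forall>k<N. w k = z k} \<subseteq> (\<lambda>w. f w i) -` B"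
    proof
      fix w assume "w \<in> {w. \<forall>k<N. w k = z k}"
      then have "f w i = f z i" using N by blast
      then show "w \<in> (\<lambda>w. f w i) -` B" using z by simp
    qed
    then show "\<exists>T. open T \<and> z \<in> T \<and> T \<subseteq> (\<lambda>w. f w i) -` B"
      using open_cylinder[of N z] by blast
  qed
  then show "continuous_on UNIV (\<lambda>w. f w i)"
    by (simp add: continuous_on_open_vimage)
qed

lemma closed_Baire_retract:
  fixes F :: "(nat \<Rightarrow> nat) set"
  assumes "closed F" "F \<noteq> {}"
  obtains r :: "(nat \<Rightarrow> nat) \<Rightarrow> nat \<Rightarrow> nat" where "continuous_on UNIV r" "range r = F"
proof -
  txt \<open>
    The retraction fixes \<open>F\<close> and sends any other point to a chosen element of \<open>F\<close> that shares the
    longest possible initial segment with it.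
  \<close>
  define ext where "ext z n \<longleftrightarrow> (\<exists>w\<in>F. \<forall>k<n. w k = z k)" for z :: "nat \<Rightarrow> nat" and n
  \<comment> \<open>The shift by one makes \<open>len z\<close> the length of the longest initial
    segment that extends into \<open>F\<close>, not the first length that fails. Length 0 always
    extends because \<open>F\<close> is nonempty.\<close>
  define len where "len z = (LEAST n. \<not> ext z (Suc n))" for z
  define pick where "pick z n = (SOME w. w \<in> F \<and> (\<forall>k<n. w k = z k))" for z :: "nat \<Rightarrow> nat" and n :: nat
  define r where "r z = (if z \<in> F then z else pick z (len z))" for z
  have pick: "pick z n \<in> F \<and> (\<forall>k<n. pick z n k = z k)" if "ext z n" for z n
    unfolding pick_def by (rule someI_ex[of "\<lambda>w. w \<in> F \<and> (\<forall>k<n. w k = z k)"]) (use that[unfolded ext_def] in blast)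
  have ext0: "ext z 0" for z using assms(2) by (auto simp: ext_def)
  have len: "\<not> ext z (Suc (len z)) \<and> ext z n" if "z \<notin> F" "n \<le> len z" for z n
  proof
    have "open (- F)" "z \<in> - F" using assms(1) that by auto
    then obtain N where N: "\<forall>w. (\<forall>k<N. w k = z k) \<longrightarrow> w \<in> - F"
      by (rule open_contains_cylinder)
    then have "\<not> ext z (Suc N)" unfolding ext_def using less_SucI by blast
    then show "\<not> ext z (Suc (len z))" unfolding len_def by (rule LeastI)
    show "ext z n"
    proof (cases n)
      case (Suc m)
      then show ?thesis using that(2) not_less_Least[of m "\<lambda>n. \<not> ext z (Suc n)"]
        by (auto simp: len_def)
    qed (simp add: ext0)
  qed
  have ext_cong: "ext w n = ext z n" if "\<forall>k<n. w k = z k" for w z n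
    using that by (auto simp: ext_def)
  have rF: "r z \<in> F" for z using pick[of z "len z"] len[of z "len z"] by (auto simp: r_def)
  have "continuous_on UNIV r"
  proof (rule continuous_on_Baire_I)
    fix z i
    show "\<exists>N. \<forall>w. (\<forall>k<N. w k = z k) \<longrightarrow> r w i = r z i"
    proof (cases "z \<in> F")
      case True
      \<comment> \<open>If \<open>w\<close> lies outside \<open>F\<close> but shares its first
        \<open>Suc i\<close> values with \<open>z\<close> in \<open>F\<close>, then
        \<open>len w\<close> exceeds \<open>i\<close>. The chosen element then agrees with
        \<open>w\<close>, hence with \<open>z\<close>, at \<open>i\<close>.\<close>
      have "r w i = r z i" if w: "\<forall>k<Suc i. w k = z k" for w
      proof (cases "w \<in> F")
        case False
        have "len w \<ge> Suc i"
        proof (rule ccontr)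
          assume "\<not> len w \<ge> Suc i"
          then have "\<forall>k<Suc (len w). w k = z k" using w by auto
          then have "ext w (Suc (len w))" using True by (auto simp: ext_def)
          then show False using len[OF False, of "len w"] by auto
        qed
        then show ?thesis
          using pick[of w "len w"] len[OF False, of "len w"] False True w by (auto simp: r_def)
      qed (use True w in \<open>simp add: r_def\<close>)
      then show ?thesis by blast
    next
      case False
      \<comment> \<open>Off \<open>F\<close> the map is locally constant: both \<open>len\<close>
        and the chosen element are determined by the first \<open>Suc (len z)\<close>
        values.\<close>
      have "r w = r z" if w: "\<forall>k<Suc (len z). w k = z k" for w
      proof -
        have e: "ext w n = ext z n" if "n \<le> Suc (len z)" for n
          by (rule ext_cong) (use w that in auto)
        have "w \<notin> F" using len[OF False, of 0] w by (auto simp: ext_def)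
        have lw: "len w = len z"
        proof (rule antisym)
          show "len w \<le> len z" unfolding len_def[of w]
            by (rule Least_le) (use e[of "Suc (len z)"] len[OF False, of 0] in auto)
          then have "\<not> ext z (Suc (len w))"
            using e[of "Suc (len w)"] len[OF \<open>w \<notin> F\<close>, of 0] by auto
          then show "len z \<le> len w" unfolding len_def[of z] by (rule Least_le)
        qed
        have "pick w (len z) = pick z (len z)"
          using w by (auto simp: pick_def intro!: arg_cong[of _ _ Eps])
        then show ?thesis using False \<open>w \<notin> F\<close> lw by (simp add: r_def)
      qed
      then show ?thesis by metis
    qed
  qed
  moreover have "range r = F"
  proof (intro subset_antisym subsetI)
    fix z assume "z \<in> F" then show "z \<in> range r" by (intro range_eqI[of _ _ z]) (simp add: r_def)
  qed (use rF in auto)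
  ultimately show thesis by (rule that)
qed

text \<open>The pairing function identifies the Baire space with its own countable power;
  \<open>sec j\<close> is the \<open>j\<close>-th projection.\<close>

definition sec :: "nat \<Rightarrow> (nat \<Rightarrow> nat) \<Rightarrow> nat \<Rightarrow> nat"
  where "sec j d i = d (prod_encode (j, i))"

lemma continuous_on_sec: "continuous_on UNIV (sec j)"
  by (rule continuous_on_Baire_I) (metis sec_def lessI)

lemma ex_sec: "\<exists>d. \<forall>j. sec j d = g j"
  by (rule exI[of _ "\<lambda>k. g (fst (prod_decode k)) (snd (prod_decode k))"])
     (auto simp: sec_def fun_eq_iff)

section \<open>Analytic sets: continuous images, countable unions and intersections, Borel
  sets\<close>

lemma analytic_in_Baire_iff:
  "analytic_in euclidean (S :: (nat \<Rightarrow> nat) set) \<longleftrightarrow>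
    S = {} \<or> (\<exists>f :: (nat \<Rightarrow> nat) \<Rightarrow> nat \<Rightarrow> nat. continuous_on UNIV f \<and> range f = S)"
  by (auto simp: analytic_in_def)

lemma analytic_in_Baire_closed:
  "closed S \<Longrightarrow> analytic_in euclidean (S :: (nat \<Rightarrow> nat) set)"
  unfolding analytic_in_Baire_iff by (metis closed_Baire_retract)

text \<open>A parametrization of \<open>S\<close> takes its values in \<open>S\<close>, so composing
  it with \<open>f\<close> needs continuity only there. This matters for decoding, which is
  continuous only on exact codes.\<close>

lemma analytic_in_Baire_image:
  fixes S :: "(nat \<Rightarrow> nat) set"
  assumes "analytic_in euclidean S" "continuous_map (subtopology euclidean S) Y f"
  shows "analytic_in Y (f ` S)"
proof (cases "S = {}")
  case False
  then obtain g :: "(nat \<Rightarrow> nat) \<Rightarrow> nat \<Rightarrow> nat" where g: "continuous_on UNIV g" "range g = S"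
    using assms(1) unfolding analytic_in_Baire_iff by blast
  have "continuous_map euclidean (subtopology euclidean S) g"
    using g by (auto simp: continuous_map_in_subtopology)
  from continuous_map_compose[OF this assms(2)]
  have "continuous_map euclidean Y (f \<circ> g)" .
  moreover have "range (f \<circ> g) = f ` S" using g by auto
  moreover have "f ` S \<subseteq> topspace Y"
    using assms(2) by (auto simp: continuous_map_def)
  ultimately show ?thesis unfolding analytic_in_def by blast
qed (simp add: analytic_in_def)

text \<open>The first value of a sequence selects a parametrization, which is applied to the
  remaining values.\<close>

lemma analytic_in_Baire_UN:
  fixes S :: "nat \<Rightarrow> (nat \<Rightarrow> nat) set"
  assumes "\<And>n. analytic_in euclidean (S n)"
  shows "analytic_in euclidean (\<Union>n. S n)"
proof (cases "(\<Union>n. S n) = {}")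
  case False
  then obtain m where m: "S m \<noteq> {}" by auto
  \<comment> \<open>A parametrization has nonempty range, so empty members are replaced by a fixed
    nonempty one; the union stays the same.\<close>
  define T where "T n = (if S n = {} then S m else S n)" for n
  have T: "(\<Union>n. S n) = (\<Union>n. T n)" using m by (auto simp: T_def split: if_splits)
  have "\<exists>f :: (nat \<Rightarrow> nat) \<Rightarrow> nat \<Rightarrow> nat. continuous_on UNIV f \<and> range f = T n" for n
    using assms[of n] assms[of m] m unfolding T_def analytic_in_Baire_iff by presburger
  then obtain f :: "nat \<Rightarrow> (nat \<Rightarrow> nat) \<Rightarrow> nat \<Rightarrow> nat"
    where f: "\<And>n. continuous_on UNIV (f n)" "\<And>n. range (f n) = T n" by metis
  define h where "h z = f (z 0) (\<lambda>k. z (Suc k))" for z :: "nat \<Rightarrow> nat"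
  have "continuous_on UNIV h"
  proof (rule continuous_on_Baire_I)
    fix z :: "nat \<Rightarrow> nat" and i
    let ?V = "f (z 0) -` {y. y i = h z i}"
    have "open ?V"
      using open_coordinate_vimage[of i "{h z i}"] by (intro open_vimage f) (simp add: vimage_def)
    moreover have "(\<lambda>k. z (Suc k)) \<in> ?V" by (simp add: h_def)
    ultimately obtain N where N: "\<forall>w. (\<forall>k<N. w k = z (Suc k)) \<longrightarrow> w \<in> ?V"
      by (rule open_contains_cylinder)
    have "h w i = h z i" if "\<forall>k<Suc N. w k = z k" for w
      using that N[rule_format, of "\<lambda>k. w (Suc k)"] by (simp add: h_def)
    then show "\<exists>N. \<forall>w. (\<forall>k<N. w k = z k) \<longrightarrow> h w i = h z i" by blast
  qed
  moreover have "range h = (\<Union>n. T n)"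
  proof (intro subset_antisym subsetI)
    fix y assume "y \<in> (\<Union>n. T n)"
    then obtain n z where "y = f n z" using f(2) by blast
    then have "y = h (case_nat n z)" by (simp add: h_def)
    then show "y \<in> range h" by blast
  next
    fix y assume "y \<in> range h"
    then obtain z where "y = h z" by blast
    then have "y \<in> T (z 0)" using f(2)[of "z 0"] by (auto simp: h_def)
    then show "y \<in> (\<Union>n. T n)" by blast
  qed
  ultimately show ?thesis unfolding analytic_in_Baire_iff T by blast
qed (simp add: analytic_in_def)

text \<open>A point of the intersection has a preimage under every parametrization. Packed into one
  sequence, the families of preimages with a common value form a closed set, and that value depends
  continuously on the sequence.\<close>

lemma analytic_in_Baire_INT:
  fixes S :: "nat \<Rightarrow> (nat \<Rightarrow> nat) set"
  assumes "\<And>n. analytic_in euclidean (S n)"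
  shows "analytic_in euclidean (\<Inter>n. S n)"
proof (cases "\<exists>n. S n = {}")
  case True
  then have "(\<Inter>n. S n) = {}" by blast
  then show ?thesis by (simp add: analytic_in_def)
next
  case False
  then have "\<exists>f :: (nat \<Rightarrow> nat) \<Rightarrow> nat \<Rightarrow> nat. continuous_on UNIV f \<and> range f = S n" for n
    using assms[of n] unfolding analytic_in_Baire_iff by simp
  then obtain f :: "nat \<Rightarrow> (nat \<Rightarrow> nat) \<Rightarrow> nat \<Rightarrow> nat"
    where f: "\<And>n. continuous_on UNIV (f n)" "\<And>n. range (f n) = S n" by metis
  define g where "g n z = f n (sec n z)" for n z
  have g: "continuous_on UNIV (g n)" for n
    unfolding g_def using continuous_on_compose2[OF f(1) continuous_on_sec] by simp
  define F where "F = {z. \<forall>n i. g n z i = g 0 z i}"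
  have "closed F"
    unfolding F_def
    by (intro closed_Collect_all closed_Collect_eq continuous_on_product_then_coordinatewise[OF g])
  then have "analytic_in euclidean F" by (rule analytic_in_Baire_closed)
  moreover have "continuous_map (subtopology euclidean F) euclidean (g 0)"
    using continuous_on_subset[OF g] by auto
  ultimately have "analytic_in euclidean (g 0 ` F)" by (rule analytic_in_Baire_image)
  also have "g 0 ` F = (\<Inter>n. S n)"
  proof (intro subset_antisym subsetI)
    fix y assume "y \<in> g 0 ` F"
    then obtain z where z: "y = g 0 z" "\<And>n. g n z = g 0 z" by (auto simp: F_def fun_eq_iff)
    then show "y \<in> (\<Inter>n. S n)" using f(2) by (auto simp: g_def) (metis rangeI)
  next
    fix y assume "y \<in> (\<Inter>n. S n)"
    then have "\<exists>z. y = f n z" for n using f(2)[of n] by blast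
    then obtain z where z: "\<And>n. y = f n (z n)" by metis
    obtain d where "\<And>n. sec n d = z n" using ex_sec[of z] by blast
    then have "g n d = y" for n using z by (simp add: g_def)
    then show "y \<in> g 0 ` F" by (intro image_eqI[of _ _ d]) (simp_all add: F_def)
  qed
  finally show ?thesis .
qed

text \<open>The sets that are analytic together with their complements form a sigma-algebra
  containing the open sets.\<close>

lemma borel_imp_analytic_in_Baire:
  fixes S :: "(nat \<Rightarrow> nat) set"
  assumes "S \<in> sets borel"
  shows "analytic_in euclidean S"
proof -
  let ?P = "\<lambda>S :: (nat \<Rightarrow> nat) set. analytic_in euclidean S \<and> analytic_in euclidean (- S)"
  have open_P: "?P S" if S: "open S" for S
  proof
    \<comment> \<open>These are the points whose cylinder of length \<open>n\<close> lies in
      \<open>S\<close>. Membership depends on the first \<open>n\<close> values only, so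
      \<open>C n\<close> is closed, and an open \<open>S\<close> is the union of all
      \<open>C n\<close>.\<close>
    define C where "C n = {z. \<forall>w. (\<forall>k<n. w k = z k) \<longrightarrow> w \<in> S}" for n
    have "closed (C n)" for n
      unfolding closed_def
    proof (rule topological_space_class.openI)
      fix z assume "z \<in> - C n"
      then have "{w. \<forall>k<n. w k = z k} \<subseteq> - C n" by (auto simp: C_def)
      then show "\<exists>T. open T \<and> z \<in> T \<and> T \<subseteq> - C n"
        using open_cylinder[of n z] by blast
    qed
    moreover have "S = (\<Union>n. C n)"
    proof (intro subset_antisym subsetI)
      fix z assume "z \<in> S"
      then obtain N where "\<forall>w. (\<forall>k<N. w k = z k) \<longrightarrow> w \<in> S"
        by (rule open_contains_cylinder[OF S])
      then have "z \<in> C N" by (simp only: C_def mem_Collect_eq)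
      then show "z \<in> (\<Union>n. C n)" by blast
    next
      fix z assume "z \<in> (\<Union>n. C n)"
      then obtain n where "z \<in> C n" by blast
      then have "\<forall>w. (\<forall>k<n. w k = z k) \<longrightarrow> w \<in> S" by (simp only: C_def mem_Collect_eq)
      then show "z \<in> S" by blast
    qed
    ultimately show "analytic_in euclidean S"
      by (simp add: analytic_in_Baire_UN analytic_in_Baire_closed)
  qed (use S in \<open>simp add: analytic_in_Baire_closed closed_Compl\<close>)
  have "S \<in> sigma_sets UNIV {S. open S}" using assms by (simp add: sets_borel)
  then have "?P S"
  proof (induction rule: sigma_sets.induct)
    case (Union a)
    then have "analytic_in euclidean (\<Union>i. a i)" "analytic_in euclidean (\<Inter>i. - a i)"
      using analytic_in_Baire_UN[of a] analytic_in_Baire_INT[of "\<lambda>i. - a i"] by blast+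
    moreover have "- (\<Union>i. a i) = (\<Inter>i. - a i)" by blast
    ultimately show ?case by simp
  next
    case (Compl a)
    then show ?case by (simp add: Compl_eq_Diff_UNIV[symmetric])
  qed (use open_P[of UNIV] open_P in \<open>auto\<close>)
  then show ?thesis by blast
qed

section \<open>The Vietoris topology\<close>

lemma openin_Vietoris_subset:
  "openin Z W \<Longrightarrow> openin (Vietoris Z) {K. compactin Z K \<and> K \<subseteq> W}"
  unfolding Vietoris_def by (rule topology_generated_by_Basis) blast

lemma openin_Vietoris_hit:
  "openin Z W \<Longrightarrow> openin (Vietoris Z) {K. compactin Z K \<and> K \<inter> W \<noteq> {}}"
  unfolding Vietoris_def by (rule topology_generated_by_Basis) blast

text \<open>Alexander's subbase theorem is phrased with the left-hand topology,
  \<open>Vietoris\<close> with the right-hand one.\<close>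

lemma topology_generated_by_subbase:
  "topology (arbitrary union_of (finite intersection_of (\<lambda>x. x \<in> \<S>) relative_to \<Union>\<S>))
    = topology_generated_by \<S>" (is "?T = _")
proof (rule topology_eq[THEN iffD2], intro allI iffI)
  fix W
  assume "openin (topology_generated_by \<S>) W"
  then have "generate_topology_on \<S> W" by (rule openin_topology_generated_by)
  then show "openin ?T W"
  proof induction
    case (Basis s)
    then show ?case
      by (intro openin_subbase[THEN iffD2] union_of_inc relative_to_subset_inc intersection_of_inc)
         (auto simp: arbitrary_def)
  qed (auto intro: openin_Union)
next
  fix W assume "openin ?T W"
  then have "(arbitrary union_of (finite intersection_of (\<lambda>x. x \<in> \<S>) relative_to \<Union>\<S>)) W"
    by (simp add: openin_subbase)
  moreover have "openin (topology_generated_by \<S>) V"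
    if "(finite intersection_of (\<lambda>x. x \<in> \<S>) relative_to \<Union>\<S>) V" for V
  proof -
    from that obtain \<F> where \<F>: "finite \<F>" "\<F> \<subseteq> \<S>" "V = \<Union>\<S> \<inter> \<Inter>\<F>"
      by (auto simp: relative_to_def intersection_of_def)
    have "openin (topology_generated_by \<S>) (topspace (topology_generated_by \<S>) \<inter> \<Inter>\<F>)"
    proof (cases "\<F> = {}")
      case False
      then show ?thesis
        using \<F>(1,2) by (intro openin_Int openin_topspace openin_Inter)
          (auto intro: topology_generated_by_Basis)
    next
      case True
      then show ?thesis by (simp del: topology_generated_by_topspace)
    qed
    then show ?thesis using \<F>(3) by simp
  qed
  ultimately show "openin (topology_generated_by \<S>) W"
    by (auto simp: union_of_def)
qed

text \<open>Alexander's subbase theorem. Given a subbasic cover, remove from \<open>Z\<close> every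
  open set whose hitting set belongs to the cover. The compact remainder can only be covered by a
  member of the form \<open>K \<subseteq> W\<close>. The complement of \<open>W\<close> is then
  covered by finitely many of the removed sets, whose hitting sets catch every compact set not
  inside \<open>W\<close>.\<close>

lemma compact_space_Vietoris:
  assumes "compact_space Z"
  shows "compact_space (Vietoris Z)"
proof -
  let ?S = "{{K. compactin Z K \<and> K \<subseteq> U} | U. openin Z U} \<union>
     {{K. compactin Z K \<and> K \<inter> U \<noteq> {}} | U. openin Z U}"
  have top: "\<Union>?S = topspace (Vietoris Z)"
    by (simp add: Vietoris_def)
  show ?thesis
  proof (rule Alexander_subbase[of ?S])
    show "topology (arbitrary union_of (finite intersection_of (\<lambda>x. x \<in> ?S) relative_to \<Union>?S))
      = Vietoris Z"
      unfolding topology_generated_by_subbase Vietoris_def ..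
    fix C assume C: "C \<subseteq> ?S" "\<Union>C = topspace (Vietoris Z)"
    define \<V> where "\<V> = {V. openin Z V \<and> {K. compactin Z K \<and> K \<inter> V \<noteq> {}} \<in> C}"
    define K\<^sub>0 where "K\<^sub>0 = topspace Z - \<Union>\<V>"
    have "closedin Z K\<^sub>0"
      unfolding K\<^sub>0_def \<V>_def by (intro closedin_diff closedin_topspace openin_Union) auto
    then have K\<^sub>0: "compactin Z K\<^sub>0" using assms closedin_compact_space by blast
    then obtain c where c: "c \<in> C" "K\<^sub>0 \<in> c"
      using C(2) by (auto simp: topspace_Vietoris)
    have "c \<in> ?S" using C(1) c(1) by (rule subsetD)
    then obtain W where W: "openin Z W" "c = {K. compactin Z K \<and> K \<subseteq> W}" "K\<^sub>0 \<subseteq> W"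
    proof (elim UnE CollectE exE conjE)
      fix V assume V: "c = {K. compactin Z K \<and> K \<inter> V \<noteq> {}}" "openin Z V"
      then have "V \<in> \<V>" using c(1) by (simp add: \<V>_def)
      then have "K\<^sub>0 \<inter> V = {}" by (auto simp: K\<^sub>0_def)
      then show thesis using c(2) V(1) by simp
    qed (use c(2) that in simp)
    have "compactin Z (topspace Z - W)"
      using W(1) assms by (intro closedin_compact_space) auto
    moreover have "\<And>V. V \<in> \<V> \<Longrightarrow> openin Z V" by (simp add: \<V>_def)
    moreover have "topspace Z - W \<subseteq> \<Union>\<V>" using W(3) by (auto simp: K\<^sub>0_def)
    ultimately obtain \<F> where \<F>: "finite \<F>" "\<F> \<subseteq> \<V>" "topspace Z - W \<subseteq> \<Union>\<F>"
      by (meson compactinD)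
    let ?C = "insert c ((\<lambda>V. {K. compactin Z K \<and> K \<inter> V \<noteq> {}}) ` \<F>)"
    have sub: "?C \<subseteq> C" using c(1) \<F>(2) by (auto simp: \<V>_def)
    have "K \<in> \<Union>?C" if K: "compactin Z K" for K
    proof (cases "K \<subseteq> W")
      case False
      then obtain V where "V \<in> \<F>" "K \<inter> V \<noteq> {}"
        using \<F>(3) compactin_subset_topspace[OF K] by blast
      then show ?thesis using K by blast
    qed (use K W(2) in blast)
    then have "topspace (Vietoris Z) \<subseteq> \<Union>?C" by (auto simp: topspace_Vietoris)
    then have "\<Union>?C = topspace (Vietoris Z)" using sub C(2) by blast
    then show "\<exists>C'. finite C' \<and> C' \<subseteq> C \<and> \<Union>C' = topspace (Vietoris Z)"
      using sub \<F>(1) by (intro exI[of _ ?C]) simp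
  qed
qed

text \<open>By compactness the infimum is attained, so the two strict inequalities for it become the
  two kinds of subbasic conditions on \<open>K\<close>. Inserting 1 gives the empty set a
  value.\<close>

lemma continuous_map_Vietoris_Inf:
  fixes f :: "'a \<Rightarrow> real"
  assumes f: "continuous_map Z euclideanreal f"
  shows "continuous_map (Vietoris Z) euclideanreal (\<lambda>K. Inf (insert 1 (f ` K)))"
proof -
  let ?m = "\<lambda>K. Inf (insert 1 (f ` K))"
  have min: "(?m K < a \<longleftrightarrow> 1 < a \<or> (\<exists>x\<in>K. f x < a)) \<and> (a < ?m K \<longleftrightarrow> a < 1 \<and> (\<forall>x\<in>K. a < f x))"
    if "compactin Z K" for K a
  proof -
    have "compact (f ` K)" using image_compactin[OF that f] by simp
    then have "compact (insert 1 (f ` K))" by (rule compact_insert)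
    then obtain s where s: "s \<in> insert 1 (f ` K)" "\<forall>t\<in>insert 1 (f ` K). s \<le> t"
      using compact_attains_inf by blast
    then have "?m K = s" by (intro cInf_eq_minimum) auto
    moreover have "s < a \<longleftrightarrow> (\<exists>t\<in>insert 1 (f ` K). t < a)" "a < s \<longleftrightarrow> (\<forall>t\<in>insert 1 (f ` K). a < t)"
      using s by (meson order_le_less_trans order_less_le_trans)+
    ultimately show ?thesis by simp
  qed
  have op: "openin Z {x \<in> topspace Z. f x < a}" "openin Z {x \<in> topspace Z. f x > a}" for a
    using f by (auto simp: continuous_map_upper_lower_semicontinuous_lt)
  have "openin (Vietoris Z) {K \<in> topspace (Vietoris Z). ?m K > a}" for a
  proof (cases "a < 1")
    case True
    have "{K \<in> topspace (Vietoris Z). ?m K > a} =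
        {K. compactin Z K \<and> K \<subseteq> {x \<in> topspace Z. f x > a}}"
      using min[of _ a] True by (auto simp: topspace_Vietoris dest: compactin_subset_topspace)
    then show ?thesis by (simp only: openin_Vietoris_subset[OF op(2)])
  next
    case False
    then have "{K \<in> topspace (Vietoris Z). ?m K > a} = {}"
      using min[of _ a] by (auto simp: topspace_Vietoris)
    then show ?thesis by (simp only: openin_empty)
  qed
  moreover have "openin (Vietoris Z) {K \<in> topspace (Vietoris Z). ?m K < a}" for a
  proof (cases "1 < a")
    case False
    have "{K \<in> topspace (Vietoris Z). ?m K < a} =
        {K. compactin Z K \<and> K \<inter> {x \<in> topspace Z. f x < a} \<noteq> {}}"
      using min[of _ a] False
      by (auto simp: topspace_Vietoris disjoint_iff) (meson compactin_subset_topspace subsetD)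
    then show ?thesis by (simp only: openin_Vietoris_hit[OF op(1)])
  next
    case True
    then have "{K \<in> topspace (Vietoris Z). ?m K < a} = topspace (Vietoris Z)"
      using min[of _ a] by (auto simp: topspace_Vietoris)
    then show ?thesis by (simp only: openin_topspace)
  qed
  ultimately show ?thesis by (simp add: continuous_map_upper_lower_semicontinuous_lt)
qed

text \<open>For basic sets with the closure of \<open>U i\<close> inside \<open>U j\<close>, take a
  Urysohn function that is 0 on \<open>U i\<close> and 1 off \<open>U j\<close>. If \<open>z\<close>
  lies in \<open>K\<close> but not in \<open>L\<close>, regularity gives such a pair with
  \<open>z\<close> in \<open>U i\<close> and \<open>U j\<close> disjoint from \<open>L\<close>. The
  minimum is then at most 0 on \<open>K\<close> and equal to 1 on \<open>L\<close>.\<close>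

lemma Vietoris_separating_function:
  fixes Z :: "'a topology" and U :: "nat \<Rightarrow> 'a set"
  assumes Z: "compact_space Z" "metrizable_space Z"
    and basis: "\<And>i. openin Z (U i)" "\<And>W z. openin Z W \<Longrightarrow> z \<in> W \<Longrightarrow> \<exists>i. z \<in> U i \<and> U i \<subseteq> W"
  obtains h :: "'a set \<Rightarrow> nat \<times> nat \<Rightarrow> real"
  where "continuous_map (Vietoris Z) euclidean h" "inj_on h {K. compactin Z K}"
proof -
  have "\<exists>f :: 'a \<Rightarrow> real. continuous_map Z euclideanreal f \<and>
      (Z closure_of U i \<subseteq> U j \<longrightarrow> (\<forall>x\<in>U i. f x = 0) \<and> (\<forall>x\<in>topspace Z - U j. f x = 1))" for i j
  proof (cases "Z closure_of U i \<subseteq> U j")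
    case True
    obtain f :: "'a \<Rightarrow> real" where f: "continuous_map Z (top_of_set {0..1}) f"
      "f ` (Z closure_of U i) \<subseteq> {0}" "f ` (topspace Z - U j) \<subseteq> {1}"
    proof (rule Urysohn_lemma[of Z "Z closure_of U i" "topspace Z - U j" 0 1])
      show "normal_space Z" using Z(2) by (rule metrizable_imp_normal_space)
      show "disjnt (Z closure_of U i) (topspace Z - U j)" using True by (auto simp: disjnt_def)
    qed (use basis in auto)
    have "continuous_map Z euclideanreal f"
      using f(1) by (rule continuous_map_into_fulltopology)
    moreover have "U i \<subseteq> Z closure_of U i"
      using basis(1)[of i] by (intro closure_of_subset openin_subset)
    then have "\<forall>x\<in>U i. f x = 0" using f(2) by blast
    moreover have "\<forall>x\<in>topspace Z - U j. f x = 1" using f(3) by blast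
    ultimately show ?thesis by (intro exI[of _ f]) simp
  next
    case False
    then show ?thesis by (intro exI[of _ "\<lambda>_. 1"]) simp
  qed
  then obtain f :: "nat \<Rightarrow> nat \<Rightarrow> 'a \<Rightarrow> real" where f: "\<And>i j. continuous_map Z euclideanreal (f i j)"
      "\<And>i j x. Z closure_of U i \<subseteq> U j \<Longrightarrow> x \<in> U i \<Longrightarrow> f i j x = 0"
      "\<And>i j x. Z closure_of U i \<subseteq> U j \<Longrightarrow> x \<in> topspace Z - U j \<Longrightarrow> f i j x = 1"
    by metis
  define h where "h K = (\<lambda>(i, j). Inf (insert 1 (f i j ` K)))" for K
  have Hd: "Hausdorff_space Z" using Z(2) by (rule metrizable_imp_Hausdorff_space)
  have sep: "h K \<noteq> h L" if K: "compactin Z K" and L: "compactin Z L" and z: "z \<in> K - L" for K L z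
  proof -
    have W: "openin Z (topspace Z - L)" "z \<in> topspace Z - L"
      using compactin_imp_closedin[OF Hd L] compactin_subset_topspace[OF K] z by auto
    then obtain j where j: "z \<in> U j" "U j \<subseteq> topspace Z - L" using basis(2) by meson
    have "neighbourhood_base_of (closedin Z) Z"
      using metrizable_imp_regular_space[OF Z(2)] by (simp add: neighbourhood_base_of_closedin)
    then obtain V C where V: "openin Z V" "closedin Z C" "z \<in> V" "V \<subseteq> C" "C \<subseteq> U j"
      using basis(1)[of j] j(1) unfolding neighbourhood_base_of by meson
    obtain i where i: "z \<in> U i" "U i \<subseteq> V" using basis(2)[OF V(1,3)] by blast
    have "Z closure_of U i \<subseteq> C" using V(2,4) i(2) by (intro closure_of_minimal) auto
    then have ij: "Z closure_of U i \<subseteq> U j" using V(5) by blast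
    have "bdd_below (f i j ` K)"
      using image_compactin[OF K f(1)] by (simp add: bounded_imp_bdd_below compact_imp_bounded)
    then have "h K (i, j) \<le> f i j z"
      unfolding h_def using z by (auto intro!: cInf_lower)
    moreover have "f i j z = 0" using f(2)[OF ij i(1)] .
    moreover have "f i j ` L \<subseteq> {1}"
      using f(3)[OF ij] j(2) compactin_subset_topspace[OF L] by blast
    then have L1: "insert 1 (f i j ` L) = {1}" by blast
    have "h L (i, j) = 1" unfolding h_def case_prod_conv L1 by simp
    ultimately show ?thesis by auto
  qed
  have "inj_on h {K. compactin Z K}"
  proof (rule inj_onI)
    fix K L assume KL: "K \<in> {K. compactin Z K}" "L \<in> {K. compactin Z K}" "h K = h L"
    then have "\<not> z \<in> K - L" "\<not> z \<in> L - K" for z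
      using sep[of K L z] sep[of L K z] by auto
    then show "K = L" by blast
  qed
  moreover have "continuous_map (Vietoris Z) euclidean h"
    unfolding euclidean_product_topology[symmetric] continuous_map_componentwise_UNIV
    using continuous_map_Vietoris_Inf[OF f(1)] by (auto simp: h_def)
  ultimately show thesis using that by blast
qed

lemma ex_countable_basis:
  assumes "second_countable Z"
  obtains U :: "nat \<Rightarrow> 'a set" where "\<And>i. openin Z (U i)"
    "\<And>W z. openin Z W \<Longrightarrow> z \<in> W \<Longrightarrow> \<exists>i. z \<in> U i \<and> U i \<subseteq> W"
proof -
  obtain \<B> where \<B>: "countable \<B>" "\<forall>V\<in>\<B>. openin Z V"
      "\<forall>W z. openin Z W \<and> z \<in> W \<longrightarrow> (\<exists>V\<in>\<B>. z \<in> V \<and> V \<subseteq> W)"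
    using assms unfolding second_countable_def by blast
  \<comment> \<open>Adding the empty set makes the family nonempty, so that it can be enumerated
    even over an empty space.\<close>
  obtain U :: "nat \<Rightarrow> 'a set" where U: "range U = insert {} \<B>"
    using \<B>(1) range_from_nat_into[of "insert {} \<B>"] by (metis countable_insert insert_not_empty)
  show thesis
  proof (rule that[of U])
    show "openin Z (U i)" for i
      using \<B>(2) U by (metis insertE openin_empty rangeI)
    fix W z assume "openin Z W" "z \<in> W"
    then obtain V where "V \<in> \<B>" "z \<in> V" "V \<subseteq> W" using \<B>(3) by blast
    moreover from this obtain i where "V = U i" using U by blast
    ultimately show "\<exists>i. z \<in> U i \<and> U i \<subseteq> W" by blast
  qed
qed

text \<open>A continuous injection from a compact space into a Hausdorff space is an embedding, so
  the hyperspace is metrizable. Its compactness then yields complete metrizability and second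
  countability.\<close>

lemma Polish_space_Vietoris:
  assumes Z: "compact_space Z" "metrizable_space Z"
  shows "Polish_space (Vietoris Z)"
proof -
  have "second_countable Z" using Z by (rule compact_metrizable_imp_second_countable)
  then obtain U :: "nat \<Rightarrow> 'a set" where U: "\<And>i. openin Z (U i)"
    "\<And>W z. openin Z W \<Longrightarrow> z \<in> W \<Longrightarrow> \<exists>i. z \<in> U i \<and> U i \<subseteq> W"
    by (rule ex_countable_basis) blast
  obtain h :: "'a set \<Rightarrow> nat \<times> nat \<Rightarrow> real"
    where h: "continuous_map (Vietoris Z) euclidean h" "inj_on h {K. compactin Z K}"
    using Vietoris_separating_function[OF Z U] by blast
  have cpt: "compact_space (Vietoris Z)" using Z(1) by (rule compact_space_Vietoris)
  have met: "metrizable_space (euclidean :: (nat \<times> nat \<Rightarrow> real) topology)"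
    by (rule metrizable_space_euclidean)
  have "closed_map (Vietoris Z) euclidean h"
    by (rule T1_Spaces.continuous_imp_closed_map[OF h(1) cpt metrizable_imp_Hausdorff_space[OF met]])
  then have "embedding_map (Vietoris Z) euclidean h"
    using h by (intro injective_closed_imp_embedding_map) (auto simp: topspace_Vietoris)
  then have "Vietoris Z homeomorphic_space subtopology euclidean (h ` topspace (Vietoris Z))"
    by (rule embedding_map_imp_homeomorphic_space)
  then have "metrizable_space (Vietoris Z)"
    using homeomorphic_metrizable_space metrizable_space_subtopology[OF met] by blast
  then show ?thesis
    using cpt unfolding Polish_space_def
    by (simp add: locally_compact_imp_completely_metrizable_space compact_imp_locally_compact_space
        compact_metrizable_imp_second_countable)
qed

section \<open>Closed iterates of \<open>\<Gamma>\<close>\<close>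

lemma Gamma_mono: "E \<subseteq> F \<Longrightarrow> Gamma X E \<subseteq> Gamma X F"
  unfolding Gamma_def by (intro closure_of_mono Un_mono order_refl subsetI) (auto intro: trancl_mono)

lemma Gamma_iter_subset_topspace:
  assumes "closedin (prod_topology X X) E"
  shows "Gamma_iter X \<alpha> E \<subseteq> topspace X \<times> topspace X"
  using closedin_subset[OF Gamma_iter_closedin[OF assms]] by simp

lemma Gamma_subset_topspace: "Gamma X E \<subseteq> topspace X \<times> topspace X"
  unfolding Gamma_def using closure_of_subset_topspace[of "prod_topology X X"] by simp

lemma Gamma_topspace: "Gamma X (topspace X \<times> topspace X) = topspace X \<times> topspace X"
  using Gamma_extensive[OF order_refl] Gamma_subset_topspace by (intro subset_antisym)

text \<open>Every ordinal below the least strict upper bound of \<open>S\<close> is at most some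
  member of \<open>S\<close>, so \<open>S\<close> determines the iterate. This merges the zero,
  successor and limit clauses into one formula.\<close>

lemma Gamma_iter_least_upper:
  assumes E: "closedin (prod_topology X X) E"
    and \<sigma>: "\<sigma> = (LEAST \<sigma>. \<forall>\<beta>\<in>S. \<beta> < \<sigma>)" and S: "\<forall>\<beta>\<in>S. \<beta> < \<sigma>"
  shows "Gamma_iter X \<sigma> E =
    prod_topology X X closure_of (E \<union> (\<Union>\<beta>\<in>S. Gamma X (Gamma_iter X \<beta> E)))"
    (is "_ = ?Z closure_of ?R")
proof (rule subset_antisym)
  have sub: "?R \<subseteq> topspace ?Z"
    using closedin_subset[OF E] Gamma_subset_topspace[of X] by auto
  have R: "?R \<subseteq> ?Z closure_of ?R" by (rule closure_of_subset[OF sub])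
  have cofinal: "\<exists>\<gamma>\<in>S. \<beta> \<le> \<gamma>" if "\<beta> < \<sigma>" for \<beta>
    using not_less_Least[of \<beta> "\<lambda>\<sigma>. \<forall>\<beta>\<in>S. \<beta> < \<sigma>"] that \<sigma> by (auto simp: not_less)
  have below: "Gamma_iter X \<beta> E \<subseteq> ?R" if "\<beta> < \<sigma>" for \<beta>
  proof -
    from cofinal[OF that] obtain \<gamma> where \<gamma>: "\<gamma> \<in> S" "\<beta> \<le> \<gamma>" by blast
    then have "Gamma_iter X \<beta> E \<subseteq> Gamma_iter X (ord_succ \<gamma>) E"
      using less_ord_succ_iff[of \<beta> \<gamma>] by (intro Gamma_iter_mono[OF E]) simp
    then show ?thesis using \<gamma>(1) by (auto simp: Gamma_iter_succ)
  qed
  consider "\<sigma> = ord_zero" | \<gamma> where "\<sigma> = ord_succ \<gamma>" | "ord_limit \<sigma>"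
    by (auto simp: ord_limit_def)
  then show "Gamma_iter X \<sigma> E \<subseteq> ?Z closure_of ?R"
  proof cases
    case 1
    then show ?thesis using R by (auto simp: Gamma_iter_zero)
  next
    case 2
    \<comment> \<open>Below a successor the cofinal member of \<open>S\<close> is the predecessor
      itself, so the last application of \<open>Gamma\<close> occurs in the union.\<close>
    then obtain \<delta> where "\<delta> \<in> S" "\<gamma> \<le> \<delta>" using cofinal[of \<gamma>] less_ord_succ by blast
    moreover from this have "\<delta> = \<gamma>" using S 2 less_ord_succ_iff by force
    ultimately show ?thesis using R by (auto simp: 2 Gamma_iter_succ)
  next
    case 3
    then show ?thesis
      unfolding Gamma_iter_limit[OF 3] using below by (intro closure_of_mono) blast
  qed
  have "E \<subseteq> Gamma_iter X \<sigma> E"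
    using Gamma_iter_mono[OF E ord_zero_le] by (simp add: Gamma_iter_zero)
  moreover have "Gamma X (Gamma_iter X \<beta> E) \<subseteq> Gamma_iter X \<sigma> E" if "\<beta> \<in> S" for \<beta>
  proof -
    have "ord_succ \<beta> \<le> \<sigma>" using S that less_ord_succ_iff[of \<sigma> \<beta>] by (meson not_less)
    from Gamma_iter_mono[OF E this] show ?thesis by (simp add: Gamma_iter_succ)
  qed
  ultimately show "?Z closure_of ?R \<subseteq> Gamma_iter X \<sigma> E"
    by (intro closure_of_minimal Gamma_iter_closedin[OF E]) blast
qed

text \<open>Every ordinal is the least strict upper bound of its predecessors.\<close>

lemma Gamma_iter_unfold:
  assumes E: "closedin (prod_topology X X) E"
  shows "Gamma_iter X \<alpha> E =
    prod_topology X X closure_of (E \<union> (\<Union>\<beta>\<in>{..<\<alpha>}. Gamma X (Gamma_iter X \<beta> E)))"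
proof -
  have "(LEAST \<sigma>. \<forall>\<beta>\<in>{..<\<alpha>}. \<beta> < \<sigma>) = \<alpha>"
  proof (rule Least_equality)
    fix \<sigma> assume "\<forall>\<beta>\<in>{..<\<alpha>}. \<beta> < \<sigma>"
    then show "\<alpha> \<le> \<sigma>" by (metis lessThan_iff not_less order_less_irrefl)
  qed simp
  then show ?thesis using Gamma_iter_least_upper[OF E, of \<alpha> "{..<\<alpha>}"] by simp
qed

text \<open>Induction along \<open>Gamma_iter_unfold\<close>. It makes the stable iterate the least
  closed \<open>Gamma\<close>-invariant set containing \<open>E\<close>.\<close>

lemma Gamma_iter_subset_closed:
  assumes E: "closedin (prod_topology X X) E" and "closedin (prod_topology X X) F"
    and "E \<subseteq> F" "Gamma X F \<subseteq> F"
  shows "Gamma_iter X \<alpha> E \<subseteq> F"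
proof (induction \<alpha> rule: less_induct)
  case (less \<alpha>)
  have "Gamma X (Gamma_iter X \<beta> E) \<subseteq> F" if "\<beta> < \<alpha>" for \<beta>
    using Gamma_mono[OF less[OF that]] assms(4) by blast
  then show ?case
    unfolding Gamma_iter_unfold[OF E, of \<alpha>]
    using assms(2,3) by (intro closure_of_minimal) blast
qed

text \<open>The iterate at the rank is closed and invariant, so it contains all iterates; it is full
  as soon as one of them is.\<close>

lemma C_Gamma_iff:
  assumes X: "compact_space X" "metrizable_space X"
  shows "A \<in> C_Gamma X \<longleftrightarrow>
    compactin (prod_topology X X) A \<and> (\<exists>\<alpha>. Gamma_iter X \<alpha> A = topspace X \<times> topspace X)"
    (is "_ \<longleftrightarrow> ?R")
proof
  assume ?R
  then obtain \<alpha> where A: "compactin (prod_topology X X) A"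
    and \<alpha>: "Gamma_iter X \<alpha> A = topspace X \<times> topspace X" by blast
  let ?\<rho> = "Gamma_rank X A"
  have "metrizable_space (prod_topology X X)"
    by (rule iffD2[OF metrizable_space_prod_topology disjI2[OF conjI[OF X(2) X(2)]]])
  then have cl: "closedin (prod_topology X X) A"
    using A by (intro compactin_imp_closedin metrizable_imp_Hausdorff_space)
  have "Gamma_iter X ?\<rho> A = Gamma_iter X (ord_succ ?\<rho>) A"
    unfolding Gamma_rank_def by (rule LeastI_ex[OF Gamma_iter_stabilises[OF X A]])
  then have "Gamma X (Gamma_iter X ?\<rho> A) \<subseteq> Gamma_iter X ?\<rho> A" by (simp add: Gamma_iter_succ)
  moreover have "A \<subseteq> Gamma_iter X ?\<rho> A"
    using Gamma_iter_mono[OF cl ord_zero_le] by (simp add: Gamma_iter_zero)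
  ultimately have "Gamma_iter X \<alpha> A \<subseteq> Gamma_iter X ?\<rho> A"
    using Gamma_iter_closedin[OF cl] by (intro Gamma_iter_subset_closed[OF cl])
  then show "A \<in> C_Gamma X"
    using A \<alpha> Gamma_iter_subset_topspace[OF cl, of ?\<rho>] by (auto simp: C_Gamma_def Gamma_infinity_def)
qed (auto simp: C_Gamma_def Gamma_infinity_def)

text \<open>The full square is a fixed point of \<open>Gamma\<close>, so a stage that reaches it is
  stable. Conversely, for members of \<open>C_Gamma\<close> the iterate at the rank is full, and
  later ones are no smaller.\<close>

lemma Gamma_rank_le_iff:
  assumes "A \<in> C_Gamma X" "closedin (prod_topology X X) A"
  shows "Gamma_rank X A \<le> \<alpha> \<longleftrightarrow> Gamma_iter X \<alpha> A = topspace X \<times> topspace X"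
proof
  assume "Gamma_rank X A \<le> \<alpha>"
  from Gamma_iter_mono[OF assms(2) this] assms Gamma_iter_subset_topspace[OF assms(2), of \<alpha>]
  show "Gamma_iter X \<alpha> A = topspace X \<times> topspace X"
    by (auto simp: C_Gamma_def Gamma_infinity_def)
next
  assume "Gamma_iter X \<alpha> A = topspace X \<times> topspace X"
  then show "Gamma_rank X A \<le> \<alpha>"
    unfolding Gamma_rank_def by (intro Least_le) (simp add: Gamma_iter_succ Gamma_topspace)
qed

section \<open>Well-founded approximations\<close>

text \<open>
  If \<open>r\<close> is well-founded, the only such family consists of iterates of \<open>\<Gamma>\<close>: the set at \<open>n\<close> is the
  iterate at the ordinal height of \<open>n\<close>.
\<close>

definition Gamma_family ::
    "'a topology \<Rightarrow> (nat \<Rightarrow> nat \<Rightarrow> bool) \<Rightarrow> ('a \<times> 'a) set \<Rightarrow> (nat \<Rightarrow> ('a \<times> 'a) set) \<Rightarrow> bool"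
  where "Gamma_family X r E A \<longleftrightarrow>
    (\<forall>n. A n = prod_topology X X closure_of (E \<union> (\<Union>m\<in>{m. r m n}. Gamma X (A m))))"

lemma Gamma_familyD:
  "Gamma_family X r E A \<Longrightarrow>
    A n = prod_topology X X closure_of (E \<union> (\<Union>m\<in>{m. r m n}. Gamma X (A m)))"
  unfolding Gamma_family_def by blast

text \<open>On an infinite descending chain every member contains \<open>Gamma\<close> of the next
  one, hence by induction all iterates of \<open>E\<close>. One of these is full, against
  properness.\<close>

lemma Gamma_family_wf:
  assumes X: "compact_space X" "metrizable_space X" and E: "E \<in> C_Gamma X"
    and cl: "closedin (prod_topology X X) E"
    and fam: "Gamma_family X r E A"
    and proper: "\<And>m n. r m n \<Longrightarrow> A m \<noteq> topspace X \<times> topspace X"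
  shows "wf {(m, n). r m n}"
proof (rule ccontr)
  assume "\<not> ?thesis"
  then obtain f where f: "\<And>i. r (f (Suc i)) (f i)"
    by (auto simp: wf_iff_no_infinite_down_chain)
  have sub: "E \<union> (\<Union>m\<in>{m. r m n}. Gamma X (A m)) \<subseteq> A n" for n
    unfolding Gamma_familyD[OF fam, of n]
    using closedin_subset[OF cl] Gamma_subset_topspace[of X] by (intro closure_of_subset) auto
  have clA: "closedin (prod_topology X X) (A n)" for n
    unfolding Gamma_familyD[OF fam, of n] by (rule closedin_closure_of)
  \<comment> \<open>The claim ranges over the whole chain because the step at \<open>f i\<close>
    uses the hypothesis at \<open>f (Suc i)\<close>.\<close>
  have "\<forall>i. Gamma_iter X \<alpha> E \<subseteq> A (f i)" for \<alpha>
  proof (induction \<alpha> rule: less_induct)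
    case (less \<alpha>)
    note eq = Gamma_iter_unfold[OF cl, of \<alpha>]
    show ?case
    proof
      fix i
      have "Gamma X (Gamma_iter X \<beta> E) \<subseteq> A (f i)" if "\<beta> < \<alpha>" for \<beta>
      proof -
        have "Gamma X (Gamma_iter X \<beta> E) \<subseteq> Gamma X (A (f (Suc i)))"
          using less[OF that] by (intro Gamma_mono) blast
        also have "\<dots> \<subseteq> A (f i)" using sub[of "f i"] f[of i] by blast
        finally show ?thesis .
      qed
      then show "Gamma_iter X \<alpha> E \<subseteq> A (f i)"
        unfolding eq using sub[of "f i"] clA by (intro closure_of_minimal) blast
    qed
  qed
  \<comment> \<open>The index is 1 because properness concerns only points lying below another one,
    and \<open>f 1\<close> lies below \<open>f 0\<close>.\<close>
  then have "topspace X \<times> topspace X \<subseteq> A (f 1)"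
    using C_Gamma_iff[OF X, of E] E by metis
  moreover have "A (f 1) \<subseteq> topspace X \<times> topspace X"
    using closedin_subset[OF clA[of "f 1"]] by simp
  ultimately show False using proper[of "f 1" "f 0"] f[of 0] by simp
qed

text \<open>Well-founded induction: the ordinal at \<open>n\<close> is the least one above those of
  its predecessors, and it serves both families. Properness of \<open>B\<close> keeps the
  predecessors strictly below the rank of \<open>E\<close>, so the ordinal at \<open>n\<close> is at
  most that rank.\<close>

lemma Gamma_family_eq_iter:
  assumes X: "compact_space X" "metrizable_space X"
    and cl: "closedin (prod_topology X X) D" "closedin (prod_topology X X) E"
    and E: "E \<in> C_Gamma X"
    and fam: "Gamma_family X r D A" "Gamma_family X r E B"
    and proper: "\<And>m n. r m n \<Longrightarrow> B m \<noteq> topspace X \<times> topspace X"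
  shows "\<exists>\<alpha>\<le>Gamma_rank X E. A n = Gamma_iter X \<alpha> D \<and> B n = Gamma_iter X \<alpha> E"
proof (induction n rule: wf_induct_rule[OF Gamma_family_wf[OF X E cl(2) fam(2) proper]])
  case (2 n)
  let ?\<rho> = "Gamma_rank X E"
  have "\<exists>a. \<forall>m. r m n \<longrightarrow> a m \<le> ?\<rho> \<and> A m = Gamma_iter X (a m) D \<and> B m = Gamma_iter X (a m) E"
    using 2 by (intro choice) auto
  then obtain a where a: "\<And>m. r m n \<Longrightarrow> a m \<le> ?\<rho>"
    "\<And>m. r m n \<Longrightarrow> A m = Gamma_iter X (a m) D" "\<And>m. r m n \<Longrightarrow> B m = Gamma_iter X (a m) E"
    by blast
  have lt: "a m < ?\<rho>" if "r m n" for m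
  proof (rule ccontr)
    assume "\<not> a m < ?\<rho>"
    then have "B m = topspace X \<times> topspace X"
      using a(1,3)[OF that] E by (simp add: C_Gamma_def Gamma_infinity_def)
    then show False using proper[OF that] by blast
  qed
  define S where "S = a ` {m. r m n}"
  define \<sigma> where "\<sigma> = (LEAST \<sigma>. \<forall>\<beta>\<in>S. \<beta> < \<sigma>)"
  have bound: "\<forall>\<beta>\<in>S. \<beta> < ?\<rho>" using lt by (auto simp: S_def)
  then have "\<sigma> \<le> ?\<rho>" unfolding \<sigma>_def by (rule Least_le)
  moreover have "\<forall>\<beta>\<in>S. \<beta> < \<sigma>" unfolding \<sigma>_def by (rule LeastI, rule bound)
  note * = Gamma_iter_least_upper[OF _ \<sigma>_def this]
  have "A n = Gamma_iter X \<sigma> D"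
    unfolding Gamma_familyD[OF fam(1), of n] *[OF cl(1)] using a(2) by (simp add: S_def)
  moreover have "B n = Gamma_iter X \<sigma> E"
    unfolding Gamma_familyD[OF fam(2), of n] *[OF cl(2)] using a(3) by (simp add: S_def)
  ultimately show ?case by blast
qed

text \<open>The ordinals up to \<rho> are countable. They are enumerated by \<open>e\<close>,
  possibly with repetitions, and indices are compared by the ordinals they name.\<close>

lemma ex_Gamma_family:
  fixes X :: "'a topology"
  obtains r :: "nat \<Rightarrow> nat \<Rightarrow> bool" and e :: "nat \<Rightarrow> omega1"
  where "range e = {..\<rho>}" "\<And>m n. r m n \<Longrightarrow> e m < \<rho>"
    "\<And>E. closedin (prod_topology X X) E \<Longrightarrow> Gamma_family X r E (\<lambda>n. Gamma_iter X (e n) E)"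
proof -
  have "{..\<rho>} = insert \<rho> {..<\<rho>}" by auto
  then have "countable {..\<rho>}" using countable_lessThan_omega1 by simp
  then obtain e :: "nat \<Rightarrow> omega1" where e: "range e = {..\<rho>}"
    using range_from_nat_into[of "{..\<rho>}"] by (metis atMost_iff empty_iff order_refl)
  define r where "r m n \<longleftrightarrow> e m < e n" for m n
  have "Gamma_family X r E (\<lambda>n. Gamma_iter X (e n) E)"
    if E: "closedin (prod_topology X X) E" for E
    unfolding Gamma_family_def
  proof
    fix n
    note Gamma_iter_unfold[OF E, of "e n"]
    also have "{..<e n} = e ` {m. r m n}"
    proof (intro subset_antisym subsetI)
      fix \<beta> assume \<beta>: "\<beta> \<in> {..<e n}"
      moreover have "e n \<in> {..\<rho>}" using e by blast
      ultimately have "\<beta> \<in> range e" unfolding e by auto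
      then show "\<beta> \<in> e ` {m. r m n}" using \<beta> by (auto simp: r_def)
    qed (auto simp: r_def)
    finally show "Gamma_iter X (e n) E = prod_topology X X closure_of
        (E \<union> (\<Union>m\<in>{m. r m n}. Gamma X (Gamma_iter X (e m) E)))"
      by simp
  qed
  moreover have "e m < \<rho>" if "r m n" for m n
  proof -
    have "e n \<in> {..\<rho>}" using e by blast
    then show ?thesis using that by (auto simp: r_def)
  qed
  ultimately show thesis using e that by blast
qed

section \<open>Codes for compact sets\<close>

locale coded_space =
  fixes Z :: "'z topology" and U :: "nat \<Rightarrow> 'z set"
  assumes compact: "compact_space Z" and metrizable: "metrizable_space Z"
    and openin_basis: "openin Z (U i)"
    and basis: "openin Z W \<Longrightarrow> z \<in> W \<Longrightarrow> \<exists>i. z \<in> U i \<and> U i \<subseteq> W"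
begin

text \<open>The zeros of \<open>c\<close> list basic open sets to be removed, so every point of the
  Baire space codes a closed set.\<close>

definition decode :: "(nat \<Rightarrow> nat) \<Rightarrow> 'z set"
  where "decode c = topspace Z - (\<Union>i\<in>{i. c i = 0}. U i)"

text \<open>
  A set has many codes; the map \<open>decode\<close> is continuous for the Vietoris topology only on the
  exact ones.
\<close>

definition exact :: "(nat \<Rightarrow> nat) \<Rightarrow> bool"
  where "exact c \<longleftrightarrow> (\<forall>i. c i \<noteq> 0 \<longleftrightarrow> decode c \<inter> U i \<noteq> {})"

definition code :: "'z set \<Rightarrow> nat \<Rightarrow> nat"
  where "code K i = (if K \<inter> U i = {} then 0 else 1)"

lemma closedin_decode: "closedin Z (decode c)"
  unfolding decode_def using openin_basis by (intro closedin_diff closedin_topspace openin_Union) auto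

lemma compactin_decode: "compactin Z (decode c)"
  using closedin_decode compact by (rule closedin_compact_space[rotated])

lemma in_decode_iff: "z \<in> decode c \<longleftrightarrow> z \<in> topspace Z \<and> (\<forall>i. c i = 0 \<longrightarrow> z \<notin> U i)"
  unfolding decode_def by blast

lemma decode_code:
  assumes "closedin Z K"
  shows "decode (code K) = K"
proof (intro subset_antisym subsetI)
  fix z assume z: "z \<in> decode (code K)"
  show "z \<in> K"
  proof (rule ccontr)
    assume "z \<notin> K"
    then have "z \<in> topspace Z - K" using z by (simp add: decode_def)
    moreover have "openin Z (topspace Z - K)" using assms by blast
    ultimately obtain i where i: "z \<in> U i" "U i \<subseteq> topspace Z - K" using basis by meson
    then have "code K i = 0" by (auto simp: code_def)
    then show False using z i(1) by (simp only: in_decode_iff)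
  qed
qed (use closedin_subset[OF assms] in \<open>auto simp: decode_def code_def split: if_splits\<close>)

lemma exact_code: "closedin Z K \<Longrightarrow> exact (code K)"
  by (simp add: exact_def decode_code) (simp add: code_def)

lemma decode_eq_topspace_iff: "decode c = topspace Z \<longleftrightarrow> (\<forall>i. c i = 0 \<longrightarrow> U i = {})"
  using openin_subset[OF openin_basis] unfolding decode_def by blast

lemma closed_eq_iff_basis:
  assumes "closedin Z K" "closedin Z L"
  shows "K = L \<longleftrightarrow> (\<forall>i. K \<inter> U i \<noteq> {} \<longleftrightarrow> L \<inter> U i \<noteq> {})"
proof
  assume "\<forall>i. K \<inter> U i \<noteq> {} \<longleftrightarrow> L \<inter> U i \<noteq> {}"
  then have "code K = code L" by (auto simp: code_def fun_eq_iff)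
  then show "K = L" using decode_code assms by metis
qed simp

text \<open>A point of \<open>L\<close> outside the closed set \<open>K\<close> has a basic
  neighbourhood missing \<open>K\<close>. Inclusion thus becomes countably many conditions, which
  suits Borel computations.\<close>

lemma closed_subset_iff_basis:
  assumes "closedin Z K" "L \<subseteq> topspace Z"
  shows "L \<subseteq> K \<longleftrightarrow> (\<forall>i. L \<inter> U i \<noteq> {} \<longrightarrow> K \<inter> U i \<noteq> {})"
proof
  assume *: "\<forall>i. L \<inter> U i \<noteq> {} \<longrightarrow> K \<inter> U i \<noteq> {}"
  show "L \<subseteq> K"
  proof
    fix z assume z: "z \<in> L"
    show "z \<in> K"
    proof (rule ccontr)
      assume "z \<notin> K"
      then have "z \<in> topspace Z - K" using z assms(2) by blast
      moreover have "openin Z (topspace Z - K)" using assms by blast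
      ultimately obtain i where "z \<in> U i" "U i \<subseteq> topspace Z - K" using basis by meson
      then show False using * z by blast
    qed
  qed
qed blast

text \<open>The complement of the graph is the union of the open boxes on which
  \<open>c i = 0\<close> and the point lies in \<open>U i\<close>.\<close>

lemma closedin_decode_graph:
  "closedin (prod_topology (euclidean :: (nat \<Rightarrow> nat) topology) Z) {(c, z). z \<in> decode c}"
proof -
  let ?P = "prod_topology (euclidean :: (nat \<Rightarrow> nat) topology) Z"
  have "open {c :: nat \<Rightarrow> nat. c i = 0}" for i
    using open_coordinate_vimage[of i "{0}"]
    by (simp add: vimage_def)
  then have "openin ?P ({c. c i = 0} \<times> U i)" for i
    using openin_basis by (simp add: openin_prod_Times_iff)
  then have "openin ?P (\<Union>i. {c. c i = 0} \<times> U i)" by blast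
  then have "closedin ?P (topspace ?P - (\<Union>i. {c. c i = 0} \<times> U i))" by blast
  also have "topspace ?P - (\<Union>i. {c. c i = 0} \<times> U i) = {(c, z). z \<in> decode c}"
    unfolding decode_def by (intro set_eqI) (simp add: split_beta mem_Times_iff)
  finally show ?thesis .
qed

text \<open>Projection along the compact factor \<open>Z\<close> is a closed map.\<close>

lemma closed_meets_section:
  assumes "closedin (prod_topology (euclidean :: (nat \<Rightarrow> nat) topology) Z) G" "closedin Z D"
  shows "closed {c. \<exists>z\<in>D. (c, z) \<in> G}"
proof -
  have "closedin (prod_topology euclidean Z) (G \<inter> UNIV \<times> D)"
    using assms by (intro closedin_Int) (auto simp: closedin_prod_Times_iff)
  then have "closedin euclidean (fst ` (G \<inter> UNIV \<times> D))"
    using closed_map_fst[OF compact, of euclidean] unfolding closed_map_def by blast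
  also have "fst ` (G \<inter> UNIV \<times> D) = {c. \<exists>z\<in>D. (c, z) \<in> G}" by force
  finally show ?thesis by simp
qed

text \<open>An open set of a metrizable space is a countable union of closed sets, and each of these
  contributes a closed set of codes.\<close>

lemma borel_meets_section:
  assumes "closedin (prod_topology (euclidean :: (nat \<Rightarrow> nat) topology) Z) G" "openin Z W"
  shows "{c. \<exists>z\<in>W. (c, z) \<in> G} \<in> sets borel"
proof -
  have "fsigma_in Z W" using metrizable assms(2) by (rule open_imp_fsigma_in)
  then obtain D :: "nat \<Rightarrow> 'z set" where D: "\<And>n. closedin Z (D n)" "(\<Union>n. D n) = W"
    unfolding fsigma_in_ascending by blast
  have "{c. \<exists>z\<in>W. (c, z) \<in> G} = (\<Union>n. {c. \<exists>z\<in>D n. (c, z) \<in> G})"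
    unfolding D(2)[symmetric] by blast
  also have "\<dots> \<in> sets borel"
    using closed_meets_section[OF assms(1) D(1)] by (intro sets.countable_UN) auto
  finally show ?thesis .
qed

lemma borel_decode_meets: "{c. decode c \<inter> U i \<noteq> {}} \<in> sets borel"
proof -
  have "{c. decode c \<inter> U i \<noteq> {}} = {c. \<exists>z\<in>U i. (c, z) \<in> {(c, z). z \<in> decode c}}" by auto
  then show ?thesis using borel_meets_section[OF closedin_decode_graph openin_basis] by simp
qed

text \<open>That \<open>decode c\<close> lies in an open \<open>W\<close> is an open condition on
  arbitrary codes, as its failure is a closed projection. That it hits \<open>W\<close> is read off
  some \<open>c i \<noteq> 0\<close> with \<open>U i \<subseteq> W\<close>; here exactness
  enters.\<close>

lemma continuous_map_decode:
  "continuous_map (subtopology euclidean {c. exact c}) (Vietoris Z) decode"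
  unfolding Vietoris_def
proof (rule continuous_on_generated_topo)
  let ?E = "subtopology euclidean {c. exact c}"
  fix V
  assume "V \<in> {{K. compactin Z K \<and> K \<subseteq> U} | U. openin Z U} \<union>
     {{K. compactin Z K \<and> K \<inter> U \<noteq> {}} | U. openin Z U}"
  then show "openin ?E (decode -` V \<inter> topspace ?E)"
  proof (elim UnE CollectE exE conjE)
    fix W assume V: "V = {K. compactin Z K \<and> K \<subseteq> W}" and W: "openin Z W"
    have "closedin Z (topspace Z - W)" using W by blast
    from closed_meets_section[OF closedin_decode_graph this]
    have "open (- {c. \<exists>z\<in>topspace Z - W. z \<in> decode c})" by (simp add: open_closed)
    then have "openin ?E ({c. exact c} \<inter> - {c. \<exists>z\<in>topspace Z - W. z \<in> decode c})"
      by (intro openin_open_Int)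
    also have "{c. exact c} \<inter> - {c. \<exists>z\<in>topspace Z - W. z \<in> decode c} = decode -` V \<inter> topspace ?E"
      using compactin_decode closedin_subset[OF closedin_decode] by (auto simp: V)
    finally show ?thesis .
  next
    fix W assume V: "V = {K. compactin Z K \<and> K \<inter> W \<noteq> {}}" and W: "openin Z W"
    have "open {c :: nat \<Rightarrow> nat. c i \<noteq> 0}" for i
      using open_coordinate_vimage[of i "- {0}"]
      by (simp add: vimage_def)
    then have "open (\<Union>i\<in>{i. U i \<subseteq> W}. {c :: nat \<Rightarrow> nat. c i \<noteq> 0})" by blast
    then have "openin ?E ({c. exact c} \<inter> (\<Union>i\<in>{i. U i \<subseteq> W}. {c. c i \<noteq> 0}))"
      by (intro openin_open_Int)
    also have "{c. exact c} \<inter> (\<Union>i\<in>{i. U i \<subseteq> W}. {c. c i \<noteq> 0}) = decode -` V \<inter> topspace ?E"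
    proof (intro subset_antisym subsetI)
      fix c assume "c \<in> decode -` V \<inter> topspace ?E"
      then obtain z where c: "exact c" "z \<in> decode c" "z \<in> W" by (auto simp: V)
      then obtain i where "z \<in> U i" "U i \<subseteq> W" using basis[OF W] by blast
      then show "c \<in> {c. exact c} \<inter> (\<Union>i\<in>{i. U i \<subseteq> W}. {c. c i \<noteq> 0})"
        using c unfolding exact_def by blast
    next
      fix c assume "c \<in> {c. exact c} \<inter> (\<Union>i\<in>{i. U i \<subseteq> W}. {c. c i \<noteq> 0})"
      then obtain i where c: "exact c" "U i \<subseteq> W" "c i \<noteq> 0" by blast
      then have "decode c \<inter> U i \<noteq> {}" unfolding exact_def by blast
      then show "c \<in> decode -` V \<inter> topspace ?E" using c compactin_decode by (auto simp: V)
    qed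
    finally show ?thesis .
  qed
next
  show "decode ` topspace (top_of_set {c. exact c})
    \<subseteq> \<Union> ({{K. compactin Z K \<and> K \<subseteq> U} | U. openin Z U} \<union>
     {{K. compactin Z K \<and> K \<inter> U \<noteq> {}} | U. openin Z U})"
    unfolding topology_generated_by_topspace[symmetric] Vietoris_def[symmetric] topspace_Vietoris
    using compactin_decode by blast
qed

lemma borel_exact: "{c. exact c} \<in> sets borel"
proof -
  note borel_decode_meets[measurable]
  have [measurable]: "(\<lambda>c :: nat \<Rightarrow> nat. c i) \<in> borel \<rightarrow>\<^sub>M count_space UNIV" for i
  proof -
    have "(\<lambda>c :: nat \<Rightarrow> nat. c i) \<in> borel_measurable borel"
      by (intro borel_measurable_continuous_onI continuous_on_product_coordinates)
    then show ?thesis by (simp only: measurable_cong_sets[OF refl sets_borel_eq_count_space])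
  qed
  have "Measurable.pred borel (\<lambda>c. \<forall>i. c i \<noteq> 0 \<longleftrightarrow> c \<in> {c. decode c \<inter> U i \<noteq> {}})"
    by measurable
  then show ?thesis by (simp add: exact_def pred_def)
qed

end

section \<open>The operator \<open>Gamma\<close> on codes\<close>

locale coded_square = coded_space "prod_topology X X" U
  for X :: "'a topology" and U +
  assumes compact_X: "compact_space X"
begin

text \<open>Composing with one more factor projects away the intermediate point, which ranges over
  the compact space \<open>X\<close>; closedness survives by induction.\<close>

lemma closedin_relpow_graph:
  "closedin (prod_topology (euclidean :: (nat \<Rightarrow> nat) topology) (prod_topology X X))
    {(c, p). p \<in> decode c ^^ Suc k}"
proof (induction k)
  case 0
  then show ?case using closedin_decode_graph by simp
next
  case (Suc k)
  let ?B = "euclidean :: (nat \<Rightarrow> nat) topology"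
  let ?Y = "prod_topology ?B (prod_topology X X)"
  \<comment> \<open>For \<open>q = ((c, (a, b)), u)\<close> with intermediate point
    \<open>u\<close>, these maps give \<open>(c, (a, u))\<close> and
    \<open>(c, (u, b))\<close>.\<close>
  let ?f = "\<lambda>q. (fst (fst q), fst (snd (fst q)), snd q)"
    and ?g = "\<lambda>q. (fst (fst q), snd q, snd (snd (fst q)))"
  define G where "G = {(c, p). p \<in> decode c ^^ Suc k}"
  define H where "H = {(c, z). z \<in> decode c}"
  have p: "continuous_map (prod_topology ?Y X) (prod_topology X X) (snd \<circ> fst)"
    by (rule continuous_map_compose[OF continuous_map_fst continuous_map_snd])
  have c: "continuous_map (prod_topology ?Y X) ?B (\<lambda>q. fst (fst q))"
    using continuous_map_compose[OF continuous_map_fst continuous_map_fst] by (simp add: o_def)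
  have a: "continuous_map (prod_topology ?Y X) X (\<lambda>q. fst (snd (fst q)))"
    using continuous_map_compose[OF p continuous_map_fst] by (simp add: o_def)
  have b: "continuous_map (prod_topology ?Y X) X (\<lambda>q. snd (snd (fst q)))"
    using continuous_map_compose[OF p continuous_map_snd] by (simp add: o_def)
  have f: "continuous_map (prod_topology ?Y X) ?Y ?f"
    by (rule continuous_map_pairedI[OF c continuous_map_pairedI[OF a continuous_map_snd]])
  have g: "continuous_map (prod_topology ?Y X) ?Y ?g"
    by (rule continuous_map_pairedI[OF c continuous_map_pairedI[OF continuous_map_snd b]])
  let ?S = "{q \<in> topspace (prod_topology ?Y X). ?f q \<in> G} \<inter> {q \<in> topspace (prod_topology ?Y X). ?g q \<in> H}"
  have "closedin (prod_topology ?Y X) ?S"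
    using closedin_continuous_map_preimage[OF f] closedin_continuous_map_preimage[OF g]
      Suc closedin_decode_graph unfolding G_def H_def by (intro closedin_Int)
  then have "closedin ?Y (fst ` ?S)"
    using closed_map_fst[OF compact_X, of ?Y] unfolding closed_map_def by blast
  also have "fst ` ?S = {(c, p). p \<in> decode c ^^ Suc (Suc k)}"
  proof (intro subset_antisym subsetI)
    fix q assume "q \<in> {(c, p). p \<in> decode c ^^ Suc (Suc k)}"
    then obtain c a b where "q = (c, (a, b))" "(a, b) \<in> decode c ^^ Suc (Suc k)"
      by (metis (mono_tags, lifting) case_prodE mem_Collect_eq surj_pair)
    then obtain u where q: "q = (c, (a, b))" "(a, u) \<in> decode c ^^ Suc k" "(u, b) \<in> decode c"
      by (metis relpow_Suc_E)
    have "decode c \<subseteq> topspace X \<times> topspace X"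
      using closedin_subset[OF closedin_decode] by simp
    from trancl_subset_Sigma[OF this] q(2,3)
    have "a \<in> topspace X" "u \<in> topspace X" "b \<in> topspace X"
      using trancl_power[of "(a, u)" "decode c"] by blast+
    then have "(q, u) \<in> ?S" using q by (simp add: G_def H_def)
    then show "q \<in> fst ` ?S" by force
  next
    fix q assume "q \<in> fst ` ?S"
    then obtain u where "(fst q, fst (snd q), u) \<in> G" "(fst q, u, snd (snd q)) \<in> H" by auto
    then have "snd q \<in> decode (fst q) ^^ Suc (Suc k)"
      unfolding G_def H_def by (cases q) (auto intro: relpow_Suc_I simp del: relpow.simps)
    then show "q \<in> {(c, p). p \<in> decode c ^^ Suc (Suc k)}" by (simp add: split_beta)
  qed
  finally show ?case .
qed

text \<open>An open set meets a closure exactly when it meets the set itself, so the closure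
  disappears; the transitive closure is the union of the positive powers.\<close>

lemma Gamma_meets_iff:
  assumes "openin (prod_topology X X) W"
  shows "Gamma X E \<inter> W \<noteq> {} \<longleftrightarrow> Id_on (topspace X) \<inter> W \<noteq> {} \<or> (\<exists>k. E ^^ Suc k \<inter> W \<noteq> {})"
proof -
  have "Gamma X E \<inter> W \<noteq> {} \<longleftrightarrow> (E\<^sup>+ \<union> Id_on (topspace X)) \<inter> W \<noteq> {}"
    unfolding Gamma_def using openin_Int_closure_of_eq_empty[OF assms] by (metis Int_commute)
  also have "E\<^sup>+ = (\<Union>k. E ^^ Suc k)"
    by (auto simp: trancl_power gr0_conv_Suc simp del: relpow.simps) blast
  also have "(\<Union>(range A) \<union> D) \<inter> W \<noteq> {} \<longleftrightarrow> D \<inter> W \<noteq> {} \<or> (\<exists>k. A k \<inter> W \<noteq> {})"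
    for A :: "nat \<Rightarrow> ('a \<times> 'a) set" and D by blast
  finally show ?thesis .
qed

lemma borel_Gamma_meets: "{c. Gamma X (decode c) \<inter> U i \<noteq> {}} \<in> sets borel"
proof -
  have eq: "{c. Gamma X (decode c) \<inter> U i \<noteq> {}} = {c. Id_on (topspace X) \<inter> U i \<noteq> {}} \<union>
      (\<Union>k. {c. \<exists>p\<in>U i. (c, p) \<in> {(c, p). p \<in> decode c ^^ Suc k}})"
    unfolding Gamma_meets_iff[OF openin_basis] by auto
  show ?thesis
    unfolding eq
    by (intro sets.Un sets.countable_UN image_subsetI borel_meets_section[OF closedin_relpow_graph openin_basis])
       simp
qed

end

section \<open>Comparing ranks\<close>

text \<open>Properness is demanded of \<open>B\<close> only: \<open>E\<close> will be the set known
  to lie in \<open>C_Gamma\<close>, while \<open>D\<close> is arbitrary. The well-foundedness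
  obtained from \<open>B\<close> then governs both families.\<close>

definition staged :: "'a topology \<Rightarrow> (nat \<Rightarrow> nat \<Rightarrow> bool) \<Rightarrow> ('a \<times> 'a) set \<Rightarrow> ('a \<times> 'a) set \<Rightarrow>
    (nat \<Rightarrow> ('a \<times> 'a) set) \<Rightarrow> (nat \<Rightarrow> ('a \<times> 'a) set) \<Rightarrow> bool"
  where "staged X r D E A B \<longleftrightarrow> Gamma_family X r D A \<and> Gamma_family X r E B \<and>
    (\<forall>m n. r m n \<longrightarrow> B m \<noteq> topspace X \<times> topspace X)"

lemma staged_eq_iter:
  assumes X: "compact_space X" "metrizable_space X"
    and cl: "closedin (prod_topology X X) D" "closedin (prod_topology X X) E"
    and E: "E \<in> C_Gamma X" and st: "staged X r D E A B"
  shows "\<exists>\<alpha>\<le>Gamma_rank X E. A n = Gamma_iter X \<alpha> D \<and> B n = Gamma_iter X \<alpha> E"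
  using st unfolding staged_def by (intro Gamma_family_eq_iter[OF X cl E]) blast+

lemma ex_staged:
  assumes cl: "closedin (prod_topology X X) D" "closedin (prod_topology X X) E"
    and E: "E \<in> C_Gamma X"
  obtains r e where "range e = {..Gamma_rank X E}"
    "staged X r D E (\<lambda>n. Gamma_iter X (e n) D) (\<lambda>n. Gamma_iter X (e n) E)"
proof -
  obtain r :: "nat \<Rightarrow> nat \<Rightarrow> bool" and e :: "nat \<Rightarrow> omega1"
    where e: "range e = {..Gamma_rank X E}" "\<And>m n. r m n \<Longrightarrow> e m < Gamma_rank X E"
      "\<And>F. closedin (prod_topology X X) F \<Longrightarrow> Gamma_family X r F (\<lambda>n. Gamma_iter X (e n) F)"
    by (rule ex_Gamma_family[of "Gamma_rank X E" X]) blast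
  have "Gamma_iter X (e m) E \<noteq> topspace X \<times> topspace X" if "r m n" for m n
    using e(2)[OF that] Gamma_rank_le_iff[OF E cl(2)] by (metis not_less)
  then have "staged X r D E (\<lambda>n. Gamma_iter X (e n) D) (\<lambda>n. Gamma_iter X (e n) E)"
    unfolding staged_def using e(3) cl by blast
  then show thesis using e(1) that by blast
qed

text \<open>Everything is decided by whether the iterate of \<open>D\<close> at the rank of
  \<open>E\<close> is full. A guess reaches no stage beyond that rank, so a full \<open>A n\<close>
  proves the inequality. A full \<open>B n\<close> means that its stage is exactly the rank, and
  there a proper \<open>A n\<close> refutes it.\<close>

lemma rank_le_iff_staged:
  assumes X: "compact_space X" "metrizable_space X"
    and cl: "closedin (prod_topology X X) D" "closedin (prod_topology X X) E"
    and E: "E \<in> C_Gamma X"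
  shows "D \<in> C_Gamma X \<and> Gamma_rank X D \<le> Gamma_rank X E \<longleftrightarrow>
      (\<exists>r A B. staged X r D E A B \<and> (\<exists>n. A n = topspace X \<times> topspace X))" (is "?L \<longleftrightarrow> ?P")
    and "\<not> (D \<in> C_Gamma X \<and> Gamma_rank X D \<le> Gamma_rank X E) \<longleftrightarrow>
      (\<exists>r A B. staged X r D E A B \<and>
        (\<exists>n. B n = topspace X \<times> topspace X \<and> A n \<noteq> topspace X \<times> topspace X))" (is "_ \<longleftrightarrow> ?Q")
proof -
  let ?\<rho> = "Gamma_rank X E" and ?T = "topspace X \<times> topspace X"
  have "compact_space (prod_topology X X)" using X(1) compact_space_prod_topology by blast
  then have D: "compactin (prod_topology X X) D" using cl(1) closedin_compact_space by blast
  have L: "?L \<longleftrightarrow> Gamma_iter X ?\<rho> D = ?T"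
    using Gamma_rank_le_iff[OF _ cl(1)] C_Gamma_iff[OF X, of D] D by blast
  obtain r e where re: "range e = {..?\<rho>}"
    "staged X r D E (\<lambda>n. Gamma_iter X (e n) D) (\<lambda>n. Gamma_iter X (e n) E)"
    using ex_staged[OF cl E] by blast
  have "?\<rho> \<in> range e" unfolding re(1) by simp
  then obtain k where k: "e k = ?\<rho>" by force
  have T: "Gamma_iter X ?\<rho> E = ?T" using Gamma_rank_le_iff[OF E cl(2)] by blast
  show "?L \<longleftrightarrow> ?P"
  proof
    assume ?L
    then have "Gamma_iter X (e k) D = ?T" using L k by simp
    then show ?P using re(2) by blast
  next
    assume ?P
    then obtain r A B n where st: "staged X r D E A B" and n: "A n = ?T" by blast
    obtain \<alpha> where "\<alpha> \<le> ?\<rho>" "A n = Gamma_iter X \<alpha> D"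
      using staged_eq_iter[OF X cl E st] by blast
    then have "?T \<subseteq> Gamma_iter X ?\<rho> D" using Gamma_iter_mono[OF cl(1)] n by metis
    then show ?L using L Gamma_iter_subset_topspace[OF cl(1)] by blast
  qed
  show "\<not> ?L \<longleftrightarrow> ?Q"
  proof
    assume "\<not> ?L"
    then have "Gamma_iter X (e k) D \<noteq> ?T" using L k by simp
    moreover have "Gamma_iter X (e k) E = ?T" using T k by simp
    ultimately show ?Q using re(2) by blast
  next
    assume ?Q
    then obtain r A B n where st: "staged X r D E A B" and n: "B n = ?T" "A n \<noteq> ?T" by blast
    obtain \<alpha> where \<alpha>: "\<alpha> \<le> ?\<rho>" "A n = Gamma_iter X \<alpha> D" "B n = Gamma_iter X \<alpha> E"
      using staged_eq_iter[OF X cl E st] by blast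
    then have "?\<rho> \<le> \<alpha>" using Gamma_rank_le_iff[OF E cl(2)] n by metis
    then show "\<not> ?L" using L \<alpha> n by (metis order_antisym)
  qed
qed

text \<open>The stable iterate serves as \<open>F\<close>, and conversely such an \<open>F\<close>
  bounds all iterates. Ordinals give way to one existential quantifier over closed sets, which makes
  the complement analytic.\<close>

lemma not_C_Gamma_iff:
  assumes X: "compact_space X" "metrizable_space X"
    and cl: "closedin (prod_topology X X) E"
  shows "E \<notin> C_Gamma X \<longleftrightarrow> (\<exists>F. closedin (prod_topology X X) F \<and> E \<subseteq> F \<and> Gamma X F \<subseteq> F \<and>
    F \<noteq> topspace X \<times> topspace X)" (is "_ \<longleftrightarrow> ?R")
proof
  have "compact_space (prod_topology X X)" using X(1) compact_space_prod_topology by blast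
  then have E: "compactin (prod_topology X X) E" using cl closedin_compact_space by blast
  let ?\<rho> = "Gamma_rank X E"
  assume "E \<notin> C_Gamma X"
  then have "Gamma_iter X ?\<rho> E \<noteq> topspace X \<times> topspace X"
    using C_Gamma_iff[OF X, of E] E by blast
  moreover have "Gamma_iter X ?\<rho> E = Gamma_iter X (ord_succ ?\<rho>) E"
    unfolding Gamma_rank_def by (rule LeastI_ex[OF Gamma_iter_stabilises[OF X E]])
  then have "Gamma X (Gamma_iter X ?\<rho> E) \<subseteq> Gamma_iter X ?\<rho> E" by (simp add: Gamma_iter_succ)
  moreover have "E \<subseteq> Gamma_iter X ?\<rho> E"
    using Gamma_iter_mono[OF cl ord_zero_le] by (simp add: Gamma_iter_zero)
  ultimately show ?R using Gamma_iter_closedin[OF cl] by blast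
next
  assume ?R
  then obtain F where F: "closedin (prod_topology X X) F" "E \<subseteq> F" "Gamma X F \<subseteq> F"
    "F \<noteq> topspace X \<times> topspace X" by blast
  have "Gamma_iter X (Gamma_rank X E) E \<subseteq> F" by (rule Gamma_iter_subset_closed[OF cl F(1-3)])
  moreover have "F \<subseteq> topspace X \<times> topspace X" using closedin_subset[OF F(1)] by simp
  ultimately show "E \<notin> C_Gamma X"
    using F(4) by (auto simp: C_Gamma_def Gamma_infinity_def)
qed

section \<open>Borel conditions on codes\<close>

lemma measurable_sec [measurable]: "sec j \<in> borel \<rightarrow>\<^sub>M borel"
  by (intro borel_measurable_continuous_onI continuous_on_sec)

lemma measurable_Baire_coordinate [measurable (raw)]:
  fixes f :: "'b \<Rightarrow> nat \<Rightarrow> nat"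
  assumes "f \<in> M \<rightarrow>\<^sub>M borel"
  shows "(\<lambda>x. f x i) \<in> M \<rightarrow>\<^sub>M count_space UNIV"
proof -
  have "(\<lambda>c :: nat \<Rightarrow> nat. c i) \<in> borel_measurable borel"
    by (intro borel_measurable_continuous_onI continuous_on_product_coordinates)
  then have "(\<lambda>c :: nat \<Rightarrow> nat. c i) \<in> borel \<rightarrow>\<^sub>M count_space UNIV"
    by (simp only: measurable_cong_sets[OF refl sets_borel_eq_count_space])
  from measurable_compose[OF assms this] show ?thesis .
qed

lemma pred_compose_borel:
  assumes "f \<in> M \<rightarrow>\<^sub>M borel" "{c. P c} \<in> sets borel"
  shows "Measurable.pred M (\<lambda>x. P (f x))"
proof -
  have "Measurable.pred borel P" using assms(2) by (simp add: pred_def)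
  from measurable_compose[OF assms(1) this] show ?thesis .
qed

context coded_square
begin

lemma pred_decode_meets [measurable (raw)]:
  "f \<in> M \<rightarrow>\<^sub>M borel \<Longrightarrow> Measurable.pred M (\<lambda>x. decode (f x) \<inter> U i \<noteq> {})"
  by (rule pred_compose_borel[OF _ borel_decode_meets])

lemma pred_Gamma_meets [measurable (raw)]:
  "f \<in> M \<rightarrow>\<^sub>M borel \<Longrightarrow> Measurable.pred M (\<lambda>x. Gamma X (decode (f x)) \<inter> U i \<noteq> {})"
  by (rule pred_compose_borel[OF _ borel_Gamma_meets])

lemma pred_exact [measurable (raw)]:
  "f \<in> M \<rightarrow>\<^sub>M borel \<Longrightarrow> Measurable.pred M (\<lambda>x. exact (f x))"
  by (rule pred_compose_borel[OF _ borel_exact])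

lemma pred_decode_eq_topspace [measurable (raw)]:
  assumes [measurable]: "f \<in> M \<rightarrow>\<^sub>M borel"
  shows "Measurable.pred M (\<lambda>x. decode (f x) = topspace X \<times> topspace X)"
  using decode_eq_topspace_iff by simp

lemma pred_decode_subset [measurable (raw)]:
  assumes [measurable]: "f \<in> M \<rightarrow>\<^sub>M borel" "g \<in> M \<rightarrow>\<^sub>M borel"
  shows "Measurable.pred M (\<lambda>x. decode (f x) \<subseteq> decode (g x))"
  using closed_subset_iff_basis[OF closedin_decode closedin_subset[OF closedin_decode]] by simp

lemma pred_Gamma_subset [measurable (raw)]:
  assumes [measurable]: "f \<in> M \<rightarrow>\<^sub>M borel" "g \<in> M \<rightarrow>\<^sub>M borel"
  shows "Measurable.pred M (\<lambda>x. Gamma X (decode (f x)) \<subseteq> decode (g x))"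
proof -
  have "Gamma X (decode (f x)) \<subseteq> topspace (prod_topology X X)" for x
    using Gamma_subset_topspace[of X] by simp
  from closed_subset_iff_basis[OF closedin_decode this] show ?thesis by simp
qed

lemma Gamma_family_iff_basis:
  assumes "\<And>n. closedin (prod_topology X X) (A n)" "E \<subseteq> topspace X \<times> topspace X"
  shows "Gamma_family X r E A \<longleftrightarrow> (\<forall>n i. A n \<inter> U i \<noteq> {} \<longleftrightarrow>
    E \<inter> U i \<noteq> {} \<or> (\<exists>m. r m n \<and> Gamma X (A m) \<inter> U i \<noteq> {}))"
proof -
  have "prod_topology X X closure_of S \<inter> U i \<noteq> {} \<longleftrightarrow> S \<inter> U i \<noteq> {}" for S i
    using openin_Int_closure_of_eq_empty[OF openin_basis, of i S] by (metis Int_commute)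
  moreover have "(E \<union> (\<Union>m\<in>{m. r m n}. C m)) \<inter> V \<noteq> {} \<longleftrightarrow>
      E \<inter> V \<noteq> {} \<or> (\<exists>m. r m n \<and> C m \<inter> V \<noteq> {})" for n C V
    by blast
  ultimately show ?thesis
    unfolding Gamma_family_def closed_eq_iff_basis[OF assms(1) closedin_closure_of]
    by (simp only:)
qed

lemma pred_Gamma_family [measurable (raw)]:
  assumes [measurable]: "f \<in> M \<rightarrow>\<^sub>M borel" "\<And>n. g n \<in> M \<rightarrow>\<^sub>M borel"
    "\<And>m n. Measurable.pred M (\<lambda>x. r x m n)"
  shows "Measurable.pred M (\<lambda>x. Gamma_family X (r x) (decode (f x)) (\<lambda>n. decode (g n x)))"
proof -
  have "decode c \<subseteq> topspace X \<times> topspace X" for c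
    using closedin_subset[OF closedin_decode] by simp
  note Gamma_family_iff_basis[OF closedin_decode this]
  then show ?thesis by (simp only:) measurable
qed

section \<open>Coding a comparison of ranks by one point of the Baire space\<close>

definition rel :: "(nat \<Rightarrow> nat) \<Rightarrow> nat \<Rightarrow> nat \<Rightarrow> bool"
  where "rel d m n \<longleftrightarrow> sec 2 d (prod_encode (m, n)) \<noteq> 0"

text \<open>
  The sections of \<open>d\<close> code the two sets to be compared, the relation and the two families.
\<close>

definition witness :: "(nat \<Rightarrow> nat) \<Rightarrow> bool"
  where "witness d \<longleftrightarrow> exact (sec 0 d) \<and> exact (sec 1 d) \<and>
    staged X (rel d) (decode (sec 0 d)) (decode (sec 1 d))
      (\<lambda>n. decode (sec n (sec 3 d))) (\<lambda>n. decode (sec n (sec 4 d)))"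

text \<open>Every clause is a countable combination of Borel tests on sections. Well-foundedness of
  the relation is not among them: for \<open>E\<close> in \<open>C_Gamma\<close> it follows from
  properness.\<close>

lemma pred_witness: "Measurable.pred borel witness"
  unfolding witness_def[abs_def] staged_def rel_def[abs_def] by measurable

lemma Gamma_family_closedin:
  "Gamma_family X r E A \<Longrightarrow> closedin (prod_topology X X) (A n)"
  by (subst Gamma_familyD) auto

lemma ex_witness:
  assumes cl: "closedin (prod_topology X X) D" "closedin (prod_topology X X) E"
    and st: "staged X r D E A B"
  obtains d where "witness d" "decode (sec 0 d) = D" "decode (sec 1 d) = E"
    "\<And>n. decode (sec n (sec 3 d)) = A n" "\<And>n. decode (sec n (sec 4 d)) = B n"
proof -
  have AB: "closedin (prod_topology X X) (A n)" "closedin (prod_topology X X) (B n)" for n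
    using st Gamma_family_closedin unfolding staged_def by blast+
  obtain a b where a: "\<And>n. sec n a = code (A n)" and b: "\<And>n. sec n b = code (B n)"
    using ex_sec[of "\<lambda>n. code (A n)"] ex_sec[of "\<lambda>n. code (B n)"] by blast
  define R :: "nat \<Rightarrow> nat" where "R k = (if case_prod r (prod_decode k) then 1 else 0)" for k
  \<comment> \<open>The five pieces are packed in the order in which \<open>witness\<close> reads
    them.\<close>
  obtain d where d: "\<And>j. sec j d = [code D, code E, R, a, b] ! j"
    using ex_sec[of "\<lambda>j. [code D, code E, R, a, b] ! j"] by blast
  have dec: "decode (sec 0 d) = D" "decode (sec 1 d) = E"
    "\<And>n. decode (sec n (sec 3 d)) = A n" "\<And>n. decode (sec n (sec 4 d)) = B n"
    by (simp_all add: d a b cl AB decode_code)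
  moreover have "rel d = r" by (simp add: fun_eq_iff rel_def d R_def)
  moreover have "exact (sec 0 d)" "exact (sec 1 d)" by (simp_all add: d cl exact_code)
  ultimately have "witness d" using st by (simp add: witness_def)
  then show thesis using dec that by blast
qed

text \<open>A Borel set of codes is analytic, and decoding is continuous on it because the decoded
  sections are exact.\<close>

lemma analytic_in_decode_image:
  assumes "Measurable.pred borel S" "\<And>d. S d \<Longrightarrow> exact (sec 0 d)"
  shows "analytic_in (Vietoris (prod_topology X X)) ((\<lambda>d. decode (sec 0 d)) ` {d. S d})"
    and "(\<And>d. S d \<Longrightarrow> exact (sec 1 d)) \<Longrightarrow>
      analytic_in (prod_topology (Vietoris (prod_topology X X)) (Vietoris (prod_topology X X)))
        ((\<lambda>d. (decode (sec 0 d), decode (sec 1 d))) ` {d. S d})"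
proof -
  have S: "analytic_in euclidean {d. S d}"
    using assms(1) by (intro borel_imp_analytic_in_Baire) (simp add: pred_def)
  have *: "continuous_map (subtopology euclidean {d. S d}) (Vietoris (prod_topology X X))
      (\<lambda>d. decode (sec j d))" if "\<And>d. S d \<Longrightarrow> exact (sec j d)" for j
  proof -
    have "continuous_map (subtopology euclidean {d. S d}) (subtopology euclidean {c. exact c}) (sec j)"
      using continuous_on_subset[OF continuous_on_sec] that
      by (auto simp: continuous_map_in_subtopology)
    from continuous_map_compose[OF this continuous_map_decode] show ?thesis by (simp add: o_def)
  qed
  show "analytic_in (Vietoris (prod_topology X X)) ((\<lambda>d. decode (sec 0 d)) ` {d. S d})"
    by (rule analytic_in_Baire_image[OF S *[OF assms(2)]])
  show "analytic_in (prod_topology (Vietoris (prod_topology X X)) (Vietoris (prod_topology X X)))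
        ((\<lambda>d. (decode (sec 0 d), decode (sec 1 d))) ` {d. S d})"
    if "\<And>d. S d \<Longrightarrow> exact (sec 1 d)"
    by (rule analytic_in_Baire_image[OF S continuous_map_pairedI[OF *[OF assms(2)] *[OF that]]])
qed

lemma closedin_iff_compactin: "compactin (prod_topology X X) K \<longleftrightarrow> closedin (prod_topology X X) K"
  using compactin_imp_closedin[OF metrizable_imp_Hausdorff_space[OF metrizable]]
    closedin_compact_space[OF compact] by blast

text \<open>By \<open>not_C_Gamma_iff\<close> a set in the complement comes with an invariant closed
  set, guessed in section 1. Exactness is asked of section 0, the one decoded into the
  hyperspace.\<close>

lemma coanalytic_in_C_Gamma:
  assumes "metrizable_space X"
  shows "coanalytic_in (Vietoris (prod_topology X X)) (C_Gamma X)"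
proof -
  define S where "S d \<longleftrightarrow> exact (sec 0 d) \<and> decode (sec 0 d) \<subseteq> decode (sec 1 d) \<and>
    Gamma X (decode (sec 1 d)) \<subseteq> decode (sec 1 d) \<and> decode (sec 1 d) \<noteq> topspace X \<times> topspace X" for d
  have "Measurable.pred borel S" unfolding S_def[abs_def] by measurable
  then have "analytic_in (Vietoris (prod_topology X X)) ((\<lambda>d. decode (sec 0 d)) ` {d. S d})"
    by (rule analytic_in_decode_image(1)) (simp add: S_def)
  also have "(\<lambda>d. decode (sec 0 d)) ` {d. S d} = topspace (Vietoris (prod_topology X X)) - C_Gamma X"
  proof (intro subset_antisym subsetI)
    fix K assume "K \<in> topspace (Vietoris (prod_topology X X)) - C_Gamma X"
    then have K: "closedin (prod_topology X X) K" "K \<notin> C_Gamma X"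
      by (auto simp: topspace_Vietoris closedin_iff_compactin)
    then obtain F where F: "closedin (prod_topology X X) F" "K \<subseteq> F" "Gamma X F \<subseteq> F"
      "F \<noteq> topspace X \<times> topspace X"
      using not_C_Gamma_iff[OF compact_X assms K(1)] by blast
    obtain d where d: "\<And>j. sec j d = [code K, code F] ! j"
      using ex_sec[of "\<lambda>j. [code K, code F] ! j"] by blast
    have "decode (sec 0 d) = K" "decode (sec 1 d) = F" "exact (sec 0 d)"
      using K(1) F(1) by (simp_all add: d decode_code exact_code)
    moreover from this have "S d" using F by (simp add: S_def)
    ultimately show "K \<in> (\<lambda>d. decode (sec 0 d)) ` {d. S d}" by blast
  next
    fix K assume "K \<in> (\<lambda>d. decode (sec 0 d)) ` {d. S d}"
    then obtain d where d: "S d" "K = decode (sec 0 d)" by blast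
    then have "K \<notin> C_Gamma X"
      using not_C_Gamma_iff[OF compact_X assms closedin_decode] closedin_decode
      unfolding S_def by blast
    then show "K \<in> topspace (Vietoris (prod_topology X X)) - C_Gamma X"
      using d(2) compactin_decode by (simp add: topspace_Vietoris)
  qed
  finally show ?thesis
    by (auto simp: coanalytic_in_def topspace_Vietoris C_Gamma_def)
qed

text \<open>Passes between codes and families. The condition \<open>H\<close> at a single index is
  left open so that the inequality of ranks and its failure are both instances.\<close>

lemma mem_witness_image_iff:
  assumes "closedin (prod_topology X X) D" "closedin (prod_topology X X) E"
    and T: "\<And>d. T d \<longleftrightarrow> (\<exists>n. H (decode (sec n (sec 3 d))) (decode (sec n (sec 4 d))))"
  shows "(D, E) \<in> (\<lambda>d. (decode (sec 0 d), decode (sec 1 d))) ` {d. witness d \<and> T d} \<longleftrightarrow>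
    (\<exists>r A B. staged X r D E A B \<and> (\<exists>n. H (A n) (B n)))" (is "?L \<longleftrightarrow> ?R")
proof
  assume ?R
  then obtain r A B n where st: "staged X r D E A B" and n: "H (A n) (B n)" by blast
  obtain d where "witness d" "decode (sec 0 d) = D" "decode (sec 1 d) = E"
    "\<And>n. decode (sec n (sec 3 d)) = A n" "\<And>n. decode (sec n (sec 4 d)) = B n"
    using ex_witness[OF assms(1,2) st] by blast
  then show ?L using n by (intro image_eqI[of _ _ d]) (auto simp: T)
next
  assume ?L
  then obtain d n where d: "witness d" "D = decode (sec 0 d)" "E = decode (sec 1 d)"
    and n: "H (decode (sec n (sec 3 d))) (decode (sec n (sec 4 d)))" unfolding T by blast
  then show ?R
    by (intro exI[of _ "rel d"] exI[of _ "\<lambda>n. decode (sec n (sec 3 d))"]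
        exI[of _ "\<lambda>n. decode (sec n (sec 4 d))"] conjI exI[of _ n]) (simp_all add: witness_def)
qed

end

theorem corollary5p10:
  fixes X :: "'a topology"
  assumes "compact_space X" and "metrizable_space X"
  shows "coanalytic_rank (Vietoris (prod_topology X X)) (C_Gamma X) (Gamma_rank X)"
proof -
  let ?Z = "prod_topology X X" and ?T = "topspace X \<times> topspace X"
  let ?V = "Vietoris ?Z"
  have Z: "compact_space ?Z" "metrizable_space ?Z"
    using assms by (auto simp: compact_space_prod_topology metrizable_space_prod_topology)
  obtain U :: "nat \<Rightarrow> ('a \<times> 'a) set" where U: "\<And>i. openin ?Z (U i)"
    "\<And>W z. openin ?Z W \<Longrightarrow> z \<in> W \<Longrightarrow> \<exists>i. z \<in> U i \<and> U i \<subseteq> W"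
    using compact_metrizable_imp_second_countable[OF Z] by (rule ex_countable_basis) blast
  interpret coded_square X U
    using Z U assms(1) by unfold_locales
  note pred_witness[measurable]
  define T\<^sub>P where "T\<^sub>P d \<longleftrightarrow> (\<exists>n. decode (sec n (sec 3 d)) = ?T)" for d
  \<comment> \<open>\<open>T\<^sub>P\<close> certifies the inequality of ranks and
    \<open>T\<^sub>Q\<close> its failure, so \<open>P\<close> will be \<open>I T\<^sub>P\<close> and
    \<open>Q\<close> the complement of \<open>I T\<^sub>Q\<close>.\<close>
  define T\<^sub>Q where "T\<^sub>Q d \<longleftrightarrow> (\<exists>n. decode (sec n (sec 4 d)) = ?T \<and> decode (sec n (sec 3 d)) \<noteq> ?T)" for d
  define I where "I T = (\<lambda>d. (decode (sec 0 d), decode (sec 1 d))) ` {d. witness d \<and> T d}" for T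
  have sub: "I T \<subseteq> topspace ?V \<times> topspace ?V" for T
    using compactin_decode by (auto simp: I_def topspace_Vietoris)
  have I: "analytic_in (prod_topology ?V ?V) (I T)" if [measurable]: "Measurable.pred borel T" for T
    unfolding I_def by (rule analytic_in_decode_image(2)) (measurable, auto simp: witness_def)
  have P: "analytic_in (prod_topology ?V ?V) (I T\<^sub>P)"
    by (rule I) (unfold T\<^sub>P_def[abs_def], measurable)
  have Q: "analytic_in (prod_topology ?V ?V) (I T\<^sub>Q)"
    by (rule I) (unfold T\<^sub>Q_def[abs_def], measurable)
  have rank: "{x \<in> C_Gamma X. Gamma_rank X x \<le> Gamma_rank X y} = {x \<in> topspace ?V. (x, y) \<in> I T\<^sub>P} \<and>
      {x \<in> C_Gamma X. Gamma_rank X x \<le> Gamma_rank X y} =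
        {x \<in> topspace ?V. (x, y) \<in> topspace ?V \<times> topspace ?V - I T\<^sub>Q}"
    if y: "y \<in> C_Gamma X" for y
  proof -
    have C: "C_Gamma X \<subseteq> topspace ?V" by (auto simp: C_Gamma_def topspace_Vietoris)
    have cl: "closedin ?Z x" if "x \<in> topspace ?V" for x
      using that by (simp add: topspace_Vietoris closedin_iff_compactin)
    have y': "y \<in> topspace ?V" using y C by blast
    have "(x, y) \<in> I T\<^sub>P \<longleftrightarrow> x \<in> C_Gamma X \<and> Gamma_rank X x \<le> Gamma_rank X y"
      "(x, y) \<in> I T\<^sub>Q \<longleftrightarrow> \<not> (x \<in> C_Gamma X \<and> Gamma_rank X x \<le> Gamma_rank X y)"
      if x: "x \<in> topspace ?V" for x
      unfolding I_def
        mem_witness_image_iff[OF cl[OF x] cl[OF y'], of T\<^sub>P "\<lambda>A B. A = ?T", OF T\<^sub>P_def]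
        mem_witness_image_iff[OF cl[OF x] cl[OF y'], of T\<^sub>Q "\<lambda>A B. B = ?T \<and> A \<noteq> ?T", OF T\<^sub>Q_def]
      using rank_le_iff_staged[OF assms cl[OF x] cl[OF y'] y] by blast+
    then show ?thesis using C y' by blast
  qed
  have "topspace ?V \<times> topspace ?V - (topspace ?V \<times> topspace ?V - I T\<^sub>Q) = I T\<^sub>Q"
    using sub by blast
  with Q have "analytic_in (prod_topology ?V ?V)
      (topspace ?V \<times> topspace ?V - (topspace ?V \<times> topspace ?V - I T\<^sub>Q))"
    by (simp only:)
  then show ?thesis
    unfolding coanalytic_rank_def
    using Polish_space_Vietoris[OF Z] coanalytic_in_C_Gamma[OF assms(2)] P sub[of T\<^sub>P] rank
    by (intro conjI exI[of _ "I T\<^sub>P"] exI[of _ "topspace ?V \<times> topspace ?V - I T\<^sub>Q"]) auto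
qed

end
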